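(* Let $(M,F)$ be a connected non-Riemannian generalized Berwald surface and let $\nabla$ be a linear connection on $M$ that is compatible with $F$. Then over any coordinate neighbourhood $U\subset M$ with coordinates $u^1,u^2$, the coefficients $\Gamma_{ij}^k$ of $\nabla$ are of the form $$\Gamma_{ij}^1\circ \pi= G^{1}_{ij} -\frac{\partial f_i}{\partial y^j}\frac{\partial F}{\partial y^2}-f_i \frac{\partial^2 F}{\partial y^j \partial y^2}, \qquad \Gamma_{ij}^2\circ \pi= G^{2}_{ij} +\frac{\partial f_i}{\partial y^j}\frac{\partial F}{\partial y^1}+f_i \frac{\partial^2 F}{\partial y^j \partial y^1}\qquad (i, j=1, 2),$$ where the functions $f_1,f_2$, positively homogeneous of degree one on the nonzero vectors of $\pi^{-1}(U)$, are given along the indicatrix curves by $$f_i \circ c_p(t)=\frac{1}{\sqrt{g(V,V)}\circ c_p(t)} \left( \int_0^t \alpha_i\circ c_p(\theta)\, d\theta+k_i(p)\right) \qquad (i=1, 2)$$ and the integration constants $k_1(p),k_2(p)\in\mathbb{R}$ (depending only on $p$) satisfy, for all $t$, the equations $$\omega_i\circ c_p (t) + (\alpha_i\circ c_p)'(t)= \left(\int_0^t \alpha_i\circ c_p(\theta)\, d\theta+k_i(p)\right)(\lambda\circ c_p)'(t)+\lambda\circ c_p(t)\, \alpha_i\circ c_p(t) \qquad (i=1, 2)$$ for any $p\in U$.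
   Context: A Finsler metric on a manifold $M$ is a continuous function $F\colon TM\to\mathbb{R}$, smooth off the zero section, with $F(tv)=tF(v)$ for $t>0$, such that with $E=\frac12F^2$ the Hessian $g_{ij}=\partial^2E/\partial y^i\partial y^j$ is positive definite at all nonzero vectors. A surface is a two-dimensional manifold; a Finsler manifold is Riemannian if $F$ is the norm of a Riemannian metric. Here $\pi\colon TM\to M$ is the projection, and local coordinates $u^i$ on $M$ induce coordinates $x^i=u^i\circ\pi$, $y^i(v)=v(u^i)$ on $TM$; repeated indices are summed. $g$ denotes the metric with components $g_{ij}$ on vertical vectors, $g(\partial/\partial y^i,\partial/\partial y^j)=g_{ij}$, and $(g^{ij})=(g_{ij})^{-1}$. A linear connection $\nabla$ on $M$ (not necessarily torsion-free) with coefficients $\Gamma_{ij}^k$, $\nabla_{\partial/\partial u^i}\partial/\partial u^j=\Gamma_{ij}^k\,\partial/\partial u^k$, is compatible with $F$ if its parallel transports preserve the Finslerian length $F$ of tangent vectors. A Finsler manifold admitting a compatible linear connection is a generalized Berwald manifold (generalized Berwald surface in dimension 2). Spray data: $G^l=\frac12 g^{lm}\big(y^k\frac{\partial^2E}{\partial y^m\partial x^k}-\frac{\partial E}{\partial x^m}\big)$, $G^l_i=\partial G^l/\partial y^i$, $G^l_{ij}=\partial G^l_i/\partial y^j$, $G^l_{ijk}=\partial G^l_{ij}/\partial y^k$. Canonical horizontal sections: $X_i^h=\frac{\partial}{\partial x^i}-G^l_i\frac{\partial}{\partial y^l}$. Cartan tensor: $\mathcal C_{ijk}=\frac12\partial g_{ij}/\partial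 y^k$. Landsberg tensor: $P^l_{ij}=\frac12 g^{lm}\big(X_i^h(g_{jm})-G^k_{ij}g_{km}-G^k_{im}g_{jk}\big)$, and $P_{ijk}=g_{kl}P^l_{ij}$. For a Finsler surface set $V=\frac{\partial F}{\partial y^1}\frac{\partial}{\partial y^2}-\frac{\partial F}{\partial y^2}\frac{\partial}{\partial y^1}$ (which is tangent to the indicatrices and satisfies $g(V,V)=\det g_{ij}\neq0$), $V_0=V/\sqrt{g(V,V)}$ with components $V_0=V_0^k\,\partial/\partial y^k$. The main scalar is $\lambda=V_0^jV_0^kV_0^l\,\mathcal C_{jkl}$. Further, $$\alpha_i=V_0^jV_0^kP_{ijk}=\tfrac12F\,V_0^jV_0^kG^l_{ijk}\frac{\partial F}{\partial y^l},\qquad \omega_i=V_0^jV_0^kG^l_{ijk}\,g\Big(V_0,\frac{\partial}{\partial y^l}\Big).$$ For each $p$, $c_p$ is a parametrization of the indicatrix curve $\partial K_p=F^{-1}(1)\cap T_pM$ as an integral curve of $V_0$: $c_p'(\theta)=V_0\circ c_p(\theta)$ (the central affine arcwise parametrization). *)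

theory Defs
  imports "HOL-Analysis.Analysis"
begin

text \<open>\<open>Ck_on k S f\<close> is only meaningful for open \<open>S\<close>.\<close>

primrec Ck_on :: "nat \<Rightarrow> 'a::real_normed_vector set \<Rightarrow> ('a \<Rightarrow> 'b::real_normed_vector) \<Rightarrow> bool" where
  "Ck_on 0 S f \<longleftrightarrow> continuous_on S f"
| "Ck_on (Suc k) S f \<longleftrightarrow>
     (\<forall>x\<in>S. f differentiable (at x)) \<and> (\<forall>v. Ck_on k S (\<lambda>x. frechet_derivative f (at x) v))"

definition smooth_on :: "'a::real_normed_vector set \<Rightarrow> ('a \<Rightarrow> 'b::real_normed_vector) \<Rightarrow> bool" where
  "smooth_on S f \<longleftrightarrow> (\<forall>k. Ck_on k S f)"

text \<open>A chart \<open>(U, u)\<close> is a coordinate neighbourhood with its coordinate map; \<open>u\<close> is a total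
  function whose values outside \<open>U\<close> are irrelevant. Coordinate indices range over the
  two-element type \<open>2\<close>, with elements \<open>1\<close> and \<open>2\<close>.\<close>

type_synonym 'a chart = "'a set \<times> ('a \<Rightarrow> real^2)"

abbreviation chart_image :: "'a chart \<Rightarrow> (real^2) set" where
  "chart_image c \<equiv> snd c ` fst c"

abbreviation chart_inv :: "'a chart \<Rightarrow> real^2 \<Rightarrow> 'a" where
  "chart_inv c \<equiv> inv_into (fst c) (snd c)"

definition is_chart :: "'a topology \<Rightarrow> 'a chart \<Rightarrow> bool" where
  "is_chart M c \<longleftrightarrow> openin M (fst c) \<and> open (chart_image c) \<and>
     homeomorphic_map (subtopology M (fst c)) (top_of_set (chart_image c)) (snd c)"

definition smooth_compatible :: "'a chart \<Rightarrow> 'a chart \<Rightarrow> bool" where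
  "smooth_compatible c d \<longleftrightarrow>
     smooth_on (snd c ` (fst c \<inter> fst d)) (snd d \<circ> chart_inv c) \<and>
     smooth_on (snd d ` (fst c \<inter> fst d)) (snd c \<circ> chart_inv d)"

text \<open>The atlas is maximal, so its elements are exactly the coordinate neighbourhoods.\<close>

definition smooth_surface :: "'a topology \<Rightarrow> 'a chart set \<Rightarrow> bool" where
  "smooth_surface M A \<longleftrightarrow> Hausdorff_space M \<and> second_countable M \<and>
     (\<forall>c\<in>A. is_chart M c) \<and> (\<Union>c\<in>A. fst c) = topspace M \<and>
     (\<forall>c\<in>A. \<forall>d\<in>A. smooth_compatible c d) \<and>
     (\<forall>c. is_chart M c \<and> (\<forall>d\<in>A. smooth_compatible c d) \<longrightarrow> c \<in> A)"

definition smooth_near :: "'a chart set \<Rightarrow> 'a \<Rightarrow> ('a \<Rightarrow> real) \<Rightarrow> bool" where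
  "smooth_near A p f \<longleftrightarrow> (\<exists>c\<in>A. p \<in> fst c \<and>
     (\<exists>W. open W \<and> snd c p \<in> W \<and> W \<subseteq> chart_image c \<and> smooth_on W (f \<circ> chart_inv c)))"

text \<open>Tangent vectors at \<open>p\<close> are the derivations of the algebra of germs at \<open>p\<close> of smooth functions.
  They are represented by functionals on all functions, normalized to vanish on
  functions that are not smooth near \<open>p\<close>.\<close>

type_synonym 'a tangent = "('a \<Rightarrow> real) \<Rightarrow> real"

definition tangent_space :: "'a topology \<Rightarrow> 'a chart set \<Rightarrow> 'a \<Rightarrow> 'a tangent set" where
  "tangent_space M A p = {v.
     (\<forall>f g a b. smooth_near A p f \<longrightarrow> smooth_near A p g \<longrightarrow>
        v (\<lambda>q. a * f q + b * g q) = a * v f + b * v g) \<and>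
     (\<forall>f g. smooth_near A p f \<longrightarrow> smooth_near A p g \<longrightarrow>
        v (\<lambda>q. f q * g q) = v f * g p + f p * v g) \<and>
     (\<forall>f g W. openin M W \<longrightarrow> p \<in> W \<longrightarrow> (\<forall>q\<in>W. f q = g q) \<longrightarrow> v f = v g) \<and>
     (\<forall>f. \<not> smooth_near A p f \<longrightarrow> v f = 0)}"

text \<open>\<open>coord_vec A (U, u) i p\<close> is the tangent vector \<open>\<partial>/\<partial>u\<^sup>i\<close> at \<open>p\<close>, and \<open>vcomp (U, u) v\<close> is the
  vector with entries \<open>v(u\<^sup>1), v(u\<^sup>2)\<close>.\<close>

definition coord_vec :: "'a chart set \<Rightarrow> 'a chart \<Rightarrow> 2 \<Rightarrow> 'a \<Rightarrow> 'a tangent" where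
  "coord_vec A c i p = (\<lambda>f. if smooth_near A p f
     then deriv (\<lambda>t. f (chart_inv c (snd c p + t *\<^sub>R axis i 1))) 0 else 0)"

definition tangent_of :: "'a chart set \<Rightarrow> 'a chart \<Rightarrow> 'a \<Rightarrow> real^2 \<Rightarrow> 'a tangent" where
  "tangent_of A c p y = (\<lambda>f. \<Sum>i\<in>UNIV. y $ i * coord_vec A c i p f)"

definition vcomp :: "'a chart \<Rightarrow> 'a tangent \<Rightarrow> real^2" where
  "vcomp c v = (\<chi> i. v (\<lambda>q. snd c q $ i))"

definition smooth_field_near ::
  "'a topology \<Rightarrow> 'a chart set \<Rightarrow> 'a \<Rightarrow> ('a \<Rightarrow> 'a tangent) \<Rightarrow> bool" where
  "smooth_field_near M A p Y \<longleftrightarrow> (\<exists>c\<in>A. p \<in> fst c \<and>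
     (\<exists>W. open W \<and> snd c p \<in> W \<and> W \<subseteq> chart_image c \<and>
        (\<forall>x\<in>W. Y (chart_inv c x) \<in> tangent_space M A (chart_inv c x)) \<and>
        smooth_on W (\<lambda>x. vcomp c (Y (chart_inv c x)))))"

text \<open>Over a coordinate neighbourhood, functions on the tangent bundle are written in the induced
  coordinates as functions of \<open>x\<close> and \<open>y\<close>.\<close>

type_synonym local_fun = "real^2 \<Rightarrow> real^2 \<Rightarrow> real"

definition local_rep :: "'a chart set \<Rightarrow> 'a chart \<Rightarrow> ('a \<Rightarrow> 'a tangent \<Rightarrow> real) \<Rightarrow> local_fun" where
  "local_rep A c F = (\<lambda>x y. F (chart_inv c x) (tangent_of A c (chart_inv c x) y))"

definition pdx :: "2 \<Rightarrow> local_fun \<Rightarrow> local_fun" where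
  "pdx i h = (\<lambda>x y. deriv (\<lambda>t. h (x + t *\<^sub>R axis i 1) y) 0)"

definition pdy :: "2 \<Rightarrow> local_fun \<Rightarrow> local_fun" where
  "pdy i h = (\<lambda>x y. deriv (\<lambda>t. h x (y + t *\<^sub>R axis i 1)) 0)"

definition energy :: "local_fun \<Rightarrow> local_fun" where
  "energy L = (\<lambda>x y. (L x y)\<^sup>2 / 2)"

definition gmat :: "local_fun \<Rightarrow> 2 \<Rightarrow> 2 \<Rightarrow> local_fun" where
  "gmat L i j = pdy i (pdy j (energy L))"

definition ginv :: "local_fun \<Rightarrow> 2 \<Rightarrow> 2 \<Rightarrow> local_fun" where
  "ginv L i j = (\<lambda>x y. matrix_inv (\<chi> a b. gmat L a b x y) $ i $ j)"

text \<open>The metric \<open>g\<close> on vertical vectors \<open>v\<^sup>i \<partial>/\<partial>y\<^sup>i\<close>, \<open>w\<^sup>j \<partial>/\<partial>y\<^sup>j\<close> at \<open>(x, y)\<close>.\<close>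

definition gprod :: "local_fun \<Rightarrow> real^2 \<Rightarrow> real^2 \<Rightarrow> real^2 \<Rightarrow> real^2 \<Rightarrow> real" where
  "gprod L x y v w = (\<Sum>i\<in>UNIV. \<Sum>j\<in>UNIV. gmat L i j x y * v $ i * w $ j)"

definition spray :: "local_fun \<Rightarrow> 2 \<Rightarrow> local_fun" where
  "spray L l = (\<lambda>x y. 1/2 * (\<Sum>m\<in>UNIV. ginv L l m x y *
     ((\<Sum>k\<in>UNIV. y $ k * pdy m (pdx k (energy L)) x y) - pdx m (energy L) x y)))"

definition spray1 :: "local_fun \<Rightarrow> 2 \<Rightarrow> 2 \<Rightarrow> local_fun" where
  "spray1 L l i = pdy i (spray L l)"

definition spray2 :: "local_fun \<Rightarrow> 2 \<Rightarrow> 2 \<Rightarrow> 2 \<Rightarrow> local_fun" where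
  "spray2 L l i j = pdy j (spray1 L l i)"

definition spray3 :: "local_fun \<Rightarrow> 2 \<Rightarrow> 2 \<Rightarrow> 2 \<Rightarrow> 2 \<Rightarrow> local_fun" where
  "spray3 L l i j k = pdy k (spray2 L l i j)"

text \<open>The derivative along the canonical horizontal section \<open>X\<^sub>i\<^sup>h\<close>.\<close>

definition hderiv :: "local_fun \<Rightarrow> 2 \<Rightarrow> local_fun \<Rightarrow> local_fun" where
  "hderiv L i h = (\<lambda>x y. pdx i h x y - (\<Sum>l\<in>UNIV. spray1 L l i x y * pdy l h x y))"

definition cartan :: "local_fun \<Rightarrow> 2 \<Rightarrow> 2 \<Rightarrow> 2 \<Rightarrow> local_fun" where
  "cartan L i j k = (\<lambda>x y. 1/2 * pdy k (gmat L i j) x y)"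

text \<open>\<open>landsberg L l i j\<close> is \<open>P\<^sup>l\<^sub>i\<^sub>j\<close> and \<open>landsberg_low L i j k\<close> is \<open>P\<^sub>i\<^sub>j\<^sub>k\<close>.\<close>

definition landsberg :: "local_fun \<Rightarrow> 2 \<Rightarrow> 2 \<Rightarrow> 2 \<Rightarrow> local_fun" where
  "landsberg L l i j = (\<lambda>x y. 1/2 * (\<Sum>m\<in>UNIV. ginv L l m x y *
     (hderiv L i (gmat L j m) x y
      - (\<Sum>k\<in>UNIV. spray2 L k i j x y * gmat L k m x y)
      - (\<Sum>k\<in>UNIV. spray2 L k i m x y * gmat L j k x y))))"

definition landsberg_low :: "local_fun \<Rightarrow> 2 \<Rightarrow> 2 \<Rightarrow> 2 \<Rightarrow> local_fun" where
  "landsberg_low L i j k = (\<lambda>x y. \<Sum>l\<in>UNIV. gmat L k l x y * landsberg L l i j x y)"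

definition Vfield :: "local_fun \<Rightarrow> real^2 \<Rightarrow> real^2 \<Rightarrow> real^2" where
  "Vfield L x y = pdy 1 L x y *\<^sub>R axis 2 1 - pdy 2 L x y *\<^sub>R axis 1 1"

definition Vnorm :: "local_fun \<Rightarrow> local_fun" where
  "Vnorm L = (\<lambda>x y. sqrt (gprod L x y (Vfield L x y) (Vfield L x y)))"

definition V0 :: "local_fun \<Rightarrow> real^2 \<Rightarrow> real^2 \<Rightarrow> real^2" where
  "V0 L x y = (1 / Vnorm L x y) *\<^sub>R Vfield L x y"

definition main_scalar :: "local_fun \<Rightarrow> local_fun" where
  "main_scalar L = (\<lambda>x y. \<Sum>j\<in>UNIV. \<Sum>k\<in>UNIV. \<Sum>l\<in>UNIV.
     V0 L x y $ j * V0 L x y $ k * V0 L x y $ l * cartan L j k l x y)"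

definition alpha :: "local_fun \<Rightarrow> 2 \<Rightarrow> local_fun" where
  "alpha L i = (\<lambda>x y. \<Sum>j\<in>UNIV. \<Sum>k\<in>UNIV.
     V0 L x y $ j * V0 L x y $ k * landsberg_low L i j k x y)"

definition omega :: "local_fun \<Rightarrow> 2 \<Rightarrow> local_fun" where
  "omega L i = (\<lambda>x y. \<Sum>j\<in>UNIV. \<Sum>k\<in>UNIV. \<Sum>l\<in>UNIV.
     V0 L x y $ j * V0 L x y $ k * spray3 L l i j k x y * gprod L x y (V0 L x y) (axis l 1))"

text \<open>A parametrization of the indicatrix in the tangent plane over \<open>x\<close> as an integral curve of
  \<open>V0\<close>, given by its fibre coordinates.\<close>

definition indicatrix_param :: "local_fun \<Rightarrow> real^2 \<Rightarrow> (real \<Rightarrow> real^2) \<Rightarrow> bool" where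
  "indicatrix_param L x c \<longleftrightarrow> range c = {y. L x y = 1} \<and>
     (\<forall>t. (c has_vector_derivative V0 L x (c t)) (at t))"

definition finsler_metric ::
  "'a topology \<Rightarrow> 'a chart set \<Rightarrow> ('a \<Rightarrow> 'a tangent \<Rightarrow> real) \<Rightarrow> bool" where
  "finsler_metric M A F \<longleftrightarrow>
     (\<forall>p\<in>topspace M. \<forall>v\<in>tangent_space M A p. \<forall>t>0. F p (\<lambda>f. t * v f) = t * F p v) \<and>
     (\<forall>c\<in>A. let L = local_rep A c F in
        continuous_on (chart_image c \<times> UNIV) (\<lambda>(x, y). L x y) \<and>
        smooth_on (chart_image c \<times> (- {0})) (\<lambda>(x, y). L x y) \<and>
        (\<forall>x\<in>chart_image c. \<forall>y. y \<noteq> 0 \<longrightarrow> (\<forall>w. w \<noteq> 0 \<longrightarrow> gprod L x y w w > 0)))"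

definition riemannian_metric ::
  "'a topology \<Rightarrow> 'a chart set \<Rightarrow> ('a \<Rightarrow> 'a tangent \<Rightarrow> 'a tangent \<Rightarrow> real) \<Rightarrow> bool" where
  "riemannian_metric M A h \<longleftrightarrow>
     (\<forall>p\<in>topspace M. \<forall>v\<in>tangent_space M A p. \<forall>w\<in>tangent_space M A p.
        h p v w = h p w v \<and>
        (\<forall>z\<in>tangent_space M A p. \<forall>a b.
           h p (\<lambda>f. a * v f + b * w f) z = a * h p v z + b * h p w z) \<and>
        (v \<noteq> (\<lambda>_. 0) \<longrightarrow> h p v v > 0)) \<and>
     (\<forall>c\<in>A. \<forall>i j. smooth_on (chart_image c)
        (\<lambda>x. h (chart_inv c x) (coord_vec A c i (chart_inv c x)) (coord_vec A c j (chart_inv c x))))"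

definition riemannian ::
  "'a topology \<Rightarrow> 'a chart set \<Rightarrow> ('a \<Rightarrow> 'a tangent \<Rightarrow> real) \<Rightarrow> bool" where
  "riemannian M A F \<longleftrightarrow> (\<exists>h. riemannian_metric M A h \<and>
     (\<forall>p\<in>topspace M. \<forall>v\<in>tangent_space M A p. F p v = sqrt (h p v v)))"

text \<open>\<open>nabla p v Y\<close> is the covariant derivative of the vector field \<open>Y\<close>, smooth near \<open>p\<close>, in the
  direction of the tangent vector \<open>v\<close> at \<open>p\<close>.\<close>

type_synonym 'a connection = "'a \<Rightarrow> 'a tangent \<Rightarrow> ('a \<Rightarrow> 'a tangent) \<Rightarrow> 'a tangent"

definition christoffel ::
  "'a chart set \<Rightarrow> 'a connection \<Rightarrow> 'a chart \<Rightarrow> 2 \<Rightarrow> 2 \<Rightarrow> 2 \<Rightarrow> 'a \<Rightarrow> real" where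
  "christoffel A nabla c k i j p = vcomp c (nabla p (coord_vec A c i p) (coord_vec A c j)) $ k"

definition linear_connection ::
  "'a topology \<Rightarrow> 'a chart set \<Rightarrow> 'a connection \<Rightarrow> bool" where
  "linear_connection M A nabla \<longleftrightarrow>
     (\<forall>p\<in>topspace M. \<forall>v\<in>tangent_space M A p. \<forall>Y. smooth_field_near M A p Y \<longrightarrow>
        nabla p v Y \<in> tangent_space M A p \<and>
        (\<forall>w\<in>tangent_space M A p. \<forall>a b.
           nabla p (\<lambda>f. a * v f + b * w f) Y = (\<lambda>f. a * nabla p v Y f + b * nabla p w Y f)) \<and>
        (\<forall>Z. smooth_field_near M A p Z \<longrightarrow>
           nabla p v (\<lambda>q f. Y q f + Z q f) = (\<lambda>f. nabla p v Y f + nabla p v Z f)) \<and>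
        (\<forall>h. smooth_near A p h \<longrightarrow>
           nabla p v (\<lambda>q f. h q * Y q f) = (\<lambda>f. v h * Y p f + h p * nabla p v Y f)) \<and>
        (\<forall>Z W. openin M W \<longrightarrow> p \<in> W \<longrightarrow> (\<forall>q\<in>W. Y q = Z q) \<longrightarrow> nabla p v Y = nabla p v Z)) \<and>
     (\<forall>c\<in>A. \<forall>i j k. smooth_on (chart_image c) (\<lambda>x. christoffel A nabla c k i j (chart_inv c x)))"

definition smooth_curve :: "'a chart set \<Rightarrow> real set \<Rightarrow> (real \<Rightarrow> 'a) \<Rightarrow> bool" where
  "smooth_curve A I \<gamma> \<longleftrightarrow> (\<forall>t\<in>I. \<exists>c\<in>A. \<exists>J. open J \<and> t \<in> J \<and> J \<subseteq> I \<and> \<gamma> ` J \<subseteq> fst c \<and>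
     smooth_on J (snd c \<circ> \<gamma>))"

text \<open>The equation for parallelism of \<open>X\<close> at time \<open>t\<close> does not depend on the chart around \<open>\<gamma> t\<close>.\<close>

definition parallel_along :: "'a topology \<Rightarrow> 'a chart set \<Rightarrow> 'a connection \<Rightarrow> real set \<Rightarrow>
    (real \<Rightarrow> 'a) \<Rightarrow> (real \<Rightarrow> 'a tangent) \<Rightarrow> bool" where
  "parallel_along M A nabla I \<gamma> X \<longleftrightarrow> (\<forall>t\<in>I. X t \<in> tangent_space M A (\<gamma> t) \<and>
     (\<exists>c\<in>A. \<gamma> t \<in> fst c \<and> (\<forall>k. ((\<lambda>s. vcomp c (X s) $ k) has_real_derivative
        - (\<Sum>i\<in>UNIV. \<Sum>j\<in>UNIV. christoffel A nabla c k i j (\<gamma> t) *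
             deriv (\<lambda>s. snd c (\<gamma> s) $ i) t * vcomp c (X t) $ j)) (at t))))"

text \<open>For parallel \<open>X\<close>, the parallel transport from \<open>\<gamma> s\<close> to \<open>\<gamma> t\<close> maps \<open>X s\<close> to \<open>X t\<close>.\<close>

definition compatible_connection :: "'a topology \<Rightarrow> 'a chart set \<Rightarrow>
    ('a \<Rightarrow> 'a tangent \<Rightarrow> real) \<Rightarrow> 'a connection \<Rightarrow> bool" where
  "compatible_connection M A F nabla \<longleftrightarrow>
     (\<forall>I \<gamma> X. open I \<and> is_interval I \<and> smooth_curve A I \<gamma> \<and> parallel_along M A nabla I \<gamma> X \<longrightarrow>
        (\<forall>s\<in>I. \<forall>t\<in>I. F (\<gamma> t) (X t) = F (\<gamma> s) (X s)))"

definition generalized_berwald ::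
  "'a topology \<Rightarrow> 'a chart set \<Rightarrow> ('a \<Rightarrow> 'a tangent \<Rightarrow> real) \<Rightarrow> bool" where
  "generalized_berwald M A F \<longleftrightarrow> finsler_metric M A F \<and>
     (\<exists>nabla. linear_connection M A nabla \<and> compatible_connection M A F nabla)"

end

theory Submission
  imports Defs
begin

text \<open>
  Write \<open>E = L\<^sup>2/2\<close> in a chart. Parallel transport along coordinate lines preserves \<open>L\<close>, and differentiating
  this gives \<open>\<partial>E/\<partial>x\<^sup>i = \<Gamma>\<^sub>i\<^sub>j\<^sup>l y\<^sup>j \<partial>E/\<partial>y\<^sup>l\<close> (\<open>compatible_in_chart\<close>; parallel fields exist by \<open>linear_ode_local\<close>).
  The canonical horizontal sections also annihilate \<open>E\<close>, that is \<open>\<partial>E/\<partial>x\<^sup>i = G\<^sup>l\<^sub>i \<partial>E/\<partial>y\<^sup>l\<close> (\<open>horizontal_energy\<close>).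
  Hence the vertical vector field \<open>D\<^sub>i\<close> with components \<open>\<Gamma>\<^sub>i\<^sub>j\<^sup>l y\<^sup>j - G\<^sup>l\<^sub>i\<close> is annihilated by \<open>dE\<close>. In dimension two
  it must be a multiple of \<open>V\<close>, so \<open>D\<^sub>i = \<phi>\<^sub>i V\<^sub>0 = f\<^sub>i V\<close> with \<open>f\<^sub>i = \<phi>\<^sub>i / sqrt (g(V, V))\<close>, and \<open>f\<^sub>i\<close> inherits smoothness and
  homogeneity. Differentiating \<open>D\<^sub>i = f\<^sub>i V\<close> by \<open>y\<^sup>j\<close> yields the formula for the coefficients
  (\<open>connection_formula\<close>).

  It remains to identify \<open>\<phi>\<^sub>i\<close> along an indicatrix. The frame \<open>y, V\<^sub>0\<close> has, up to scale, the dual frame \<open>dE, g(V\<^sub>0, \<cdot>)\<close>,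
  from which the central affine parametrization satisfies \<open>c'' = - \<lambda> c' - c\<close> (\<open>dV_V0\<close>). The components of
  \<open>D\<^sub>i\<close> are homogeneous of degree one with second fibre derivatives \<open>- G\<^sup>l\<^sub>i\<^sub>j\<^sub>k\<close>, so \<open>W = D\<^sub>i \<circ> c\<close> satisfies
  \<open>W'' = - Q - \<lambda> W' - W\<close>, where \<open>Q\<^sup>l = G\<^sup>l\<^sub>i\<^sub>j\<^sub>k c'\<^sup>j c'\<^sup>k\<close>. Inserting \<open>W = \<phi>\<^sub>i c'\<close> gives
  \<open>Q = (\<lambda>' \<phi>\<^sub>i + \<lambda> \<phi>\<^sub>i' - \<phi>\<^sub>i'') c' + 2 \<phi>\<^sub>i' c\<close>. Since \<open>2 P\<^sub>i\<^sub>j\<^sub>k = G\<^sup>l\<^sub>i\<^sub>j\<^sub>k \<partial>E/\<partial>y\<^sup>l\<close> (\<open>landsberg_low_eq\<close>), applying \<open>dE\<close> to \<open>Q\<close> gives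
  \<open>\<alpha>\<^sub>i = \<phi>\<^sub>i'\<close>, and applying \<open>g(V\<^sub>0, \<cdot>)\<close> gives \<open>\<omega>\<^sub>i = \<lambda>' \<phi>\<^sub>i + \<lambda> \<phi>\<^sub>i' - \<phi>\<^sub>i''\<close> (\<open>along_indicatrix\<close>). These are the two
  claimed equations, with \<open>k\<^sub>i(p) = \<phi>\<^sub>i(c\<^sub>p(0))\<close>.
\<close>

section \<open>Calculus of \<open>C\<^sup>k\<close> functions\<close>

lemma Ck_on_cong:
  assumes "open S" "\<And>x. x \<in> S \<Longrightarrow> f x = g x" "Ck_on k S f"
  shows "Ck_on k S g"
  using assms(2,3)
proof (induction k arbitrary: f g)
  case 0
  then show ?case using continuous_on_cong[of S S f g] by simp
next
  case (Suc k)
  have *: "(g has_derivative frechet_derivative f (at x)) (at x)" if "x \<in> S" for x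
  proof -
    have "(f has_derivative frechet_derivative f (at x)) (at x)"
      using Suc.prems that by (simp add: frechet_derivative_works[symmetric])
    then show ?thesis
      using has_derivative_transform_within_open[OF _ \<open>open S\<close> that] Suc.prems(1) by blast
  qed
  have "g differentiable (at x)" if "x \<in> S" for x
    using *[OF that] by (auto simp: differentiable_def)
  moreover have "Ck_on k S (\<lambda>x. frechet_derivative g (at x) v)" for v
  proof (rule Suc.IH)
    show "frechet_derivative f (at x) v = frechet_derivative g (at x) v" if "x \<in> S" for x
      using frechet_derivative_at[OF *[OF that]] by simp
    show "Ck_on k S (\<lambda>x. frechet_derivative f (at x) v)" using Suc.prems by simp
  qed
  ultimately show ?case by simp
qed

lemma Ck_on_subset: "Ck_on k S f \<Longrightarrow> T \<subseteq> S \<Longrightarrow> Ck_on k T f"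
  by (induction k arbitrary: f) (auto intro: continuous_on_subset)

lemma Ck_on_Suc_lower: "Ck_on (Suc k) S f \<Longrightarrow> Ck_on k S f"
proof (induction k arbitrary: f)
  case 0
  then show ?case
    by (auto intro!: differentiable_imp_continuous_on
        simp: differentiable_on_def differentiable_at_withinI)
next
  case (Suc k)
  then show ?case by (metis Ck_on.simps(2))
qed

lemma Ck_on_SucI:
  assumes "open S" "\<And>x. x \<in> S \<Longrightarrow> (f has_derivative f' x) (at x)"
    and "\<And>v. Ck_on k S (\<lambda>x. f' x v)"
  shows "Ck_on (Suc k) S f"
proof -
  have "Ck_on k S (\<lambda>x. frechet_derivative f (at x) v)" for v
    by (rule Ck_on_cong[OF assms(1) _ assms(3)[of v]])
      (use assms(2) frechet_derivative_at in fastforce)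
  then show ?thesis using assms(2) by (auto simp: differentiable_def)
qed

lemma Ck_on_SucD:
  assumes "Ck_on (Suc k) S f" "x \<in> S"
  shows "(f has_derivative frechet_derivative f (at x)) (at x)"
  using assms by (simp add: frechet_derivative_works[symmetric])

lemma Ck_on_const: "open S \<Longrightarrow> Ck_on k S (\<lambda>x. c)"
proof (induction k arbitrary: c)
  case (Suc k)
  show ?case by (rule Ck_on_SucI[where f' = "\<lambda>_ _. 0"]) (use Suc in auto)
qed simp

lemma Ck_on_bounded_linear: "open S \<Longrightarrow> bounded_linear f \<Longrightarrow> Ck_on k S f"
proof (cases k)
  case 0
  then show "bounded_linear f \<Longrightarrow> ?thesis" by (simp add: linear_continuous_on)
next
  case (Suc m)
  assume "open S" "bounded_linear f"
  then show ?thesis unfolding Suc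
    by (intro Ck_on_SucI[where f' = "\<lambda>_. f"])
      (auto simp: bounded_linear_imp_has_derivative Ck_on_const)
qed

lemma Ck_on_add:
  assumes "open S" "Ck_on k S f" "Ck_on k S g"
  shows "Ck_on k S (\<lambda>x. f x + g x)"
  using assms(2,3)
proof (induction k arbitrary: f g)
  case (Suc k)
  show ?case
    by (rule Ck_on_SucI[OF assms(1) has_derivative_add
          [OF Ck_on_SucD[OF Suc.prems(1)] Ck_on_SucD[OF Suc.prems(2)]]])
      (use Suc in auto)
qed (auto intro: continuous_on_add)

lemma Ck_on_linear_comp:
  assumes "bounded_linear h" "open S" "Ck_on k S f"
  shows "Ck_on k S (\<lambda>x. h (f x))"
  using assms(3)
proof (induction k arbitrary: f)
  case 0
  then show ?case
    using bounded_linear.continuous_on[OF assms(1)] by simp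
next
  case (Suc k)
  show ?case
    by (rule Ck_on_SucI[OF assms(2) bounded_linear.has_derivative
          [OF assms(1) Ck_on_SucD[OF Suc.prems(1)]]])
      (use Suc in auto)
qed

lemma Ck_on_bilinear:
  assumes "bounded_bilinear h" "open S" "Ck_on k S f" "Ck_on k S g"
  shows "Ck_on k S (\<lambda>x. h (f x) (g x))"
  using assms(3,4)
proof (induction k arbitrary: f g)
  case 0
  then show ?case
    using bounded_bilinear.continuous_on[OF assms(1)] by simp
next
  case (Suc k)
  have "Ck_on k S f" "Ck_on k S g" using Suc.prems Ck_on_Suc_lower by blast+
  then show ?case
    by (intro Ck_on_SucI[OF assms(2) bounded_bilinear.FDERIV
          [OF assms(1) Ck_on_SucD[OF Suc.prems(1)] Ck_on_SucD[OF Suc.prems(2)]]]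
          Ck_on_add[OF assms(2)] Suc.IH)
      (use Suc in auto)
qed

lemmas Ck_on_mult = Ck_on_bilinear[OF bounded_bilinear_mult]
lemmas Ck_on_scaleR = Ck_on_bilinear[OF bounded_bilinear_scaleR]

lemma Ck_on_sum:
  assumes "open S" "finite I" "\<And>i. i \<in> I \<Longrightarrow> Ck_on k S (f i)"
  shows "Ck_on k S (\<lambda>x. \<Sum>i\<in>I. f i x)"
  using assms(2,3)
  by (induction I rule: finite_induct) (auto intro: Ck_on_add Ck_on_const assms(1))

lemma Ck_on_inverse:
  fixes f :: "'a::real_normed_vector \<Rightarrow> real"
  assumes "open S" "\<And>x. x \<in> S \<Longrightarrow> f x \<noteq> 0" "Ck_on k S f"
  shows "Ck_on k S (\<lambda>x. inverse (f x))"
  using assms(3)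
proof (induction k)
  case 0
  then show ?case using assms(2) by (auto intro: continuous_on_inverse)
next
  case (Suc k)
  have "Ck_on k S (\<lambda>x. inverse (f x))" using Suc Ck_on_Suc_lower by blast
  moreover have "Ck_on k S (\<lambda>x. frechet_derivative f (at x) v)" for v
    using Suc.prems by simp
  ultimately have "Ck_on k S (\<lambda>x. (- 1) * (inverse (f x) * frechet_derivative f (at x) v * inverse (f x)))" for v
    using assms(1) by (intro Ck_on_mult Ck_on_const)
  then show ?case
    by (intro Ck_on_SucI[OF assms(1) Deriv.has_derivative_inverse
          [OF assms(2) Ck_on_SucD[OF Suc.prems(1)]]]) simp_all
qed

lemma Ck_on_sqrt:
  fixes f :: "'a::real_normed_vector \<Rightarrow> real"
  assumes "open S" "\<And>x. x \<in> S \<Longrightarrow> 0 < f x" "Ck_on k S f"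
  shows "Ck_on k S (\<lambda>x. sqrt (f x))"
  using assms(3)
proof (induction k)
  case 0
  then show ?case by (auto intro: continuous_on_real_sqrt)
next
  case (Suc k)
  have "Ck_on k S (\<lambda>x. sqrt (f x))" using Suc Ck_on_Suc_lower by blast
  then have "Ck_on k S (\<lambda>x. inverse (sqrt (f x)))"
    by (rule Ck_on_inverse[OF assms(1), rotated]) (use assms(2) in fastforce)
  moreover have "Ck_on k S (\<lambda>x. frechet_derivative f (at x) v)" for v
    using Suc.prems by simp
  ultimately have "Ck_on k S (\<lambda>x. frechet_derivative f (at x) v * ((1/2) * inverse (sqrt (f x))))" for v
    using assms(1) by (intro Ck_on_mult Ck_on_const)
  moreover have "((\<lambda>x. sqrt (f x)) has_derivative
      (\<lambda>v. frechet_derivative f (at x) v * ((1/2) * inverse (sqrt (f x))))) (at x)" if "x \<in> S" for x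
    using DERIV_compose_FDERIV[OF DERIV_real_sqrt[OF assms(2)[OF that]] Ck_on_SucD[OF Suc.prems that]]
    by (simp add: mult.commute)
  ultimately show ?case
    by (intro Ck_on_SucI[OF assms(1)])
qed

text \<open>The target of the inner function is Euclidean, so that the derivative of the composition is a finite
  sum of products of partial derivatives and the induction needs only sums and products.\<close>

lemma Ck_on_compose:
  fixes g :: "'a::real_normed_vector \<Rightarrow> 'b::euclidean_space"
  assumes "open S" "g ` S \<subseteq> T" "Ck_on k T f" "Ck_on k S g"
  shows "Ck_on k S (\<lambda>x. f (g x))"
  using assms(3,4)
proof (induction k arbitrary: f)
  case 0
  then show ?case
    using continuous_on_compose2[of T f S g] assms(2) by simp
next
  case (Suc k)
  have g: "Ck_on k S g" using Suc.prems Ck_on_Suc_lower by blast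
  have D: "((\<lambda>x. f (g x)) has_derivative
       (\<lambda>v. \<Sum>b\<in>Basis. (frechet_derivative g (at x) v \<bullet> b) *\<^sub>R frechet_derivative f (at (g x)) b)) (at x)"
    if x: "x \<in> S" for x
  proof -
    have gx: "g x \<in> T" using x assms(2) by blast
    note df = Ck_on_SucD[OF Suc.prems(1) gx]
    interpret bl: bounded_linear "frechet_derivative f (at (g x))"
      using df has_derivative_bounded_linear by blast
    have "frechet_derivative f (at (g x)) \<circ> frechet_derivative g (at x) =
       (\<lambda>v. \<Sum>b\<in>Basis. (frechet_derivative g (at x) v \<bullet> b) *\<^sub>R frechet_derivative f (at (g x)) b)"
    proof
      fix v
      have "frechet_derivative f (at (g x)) (\<Sum>b\<in>Basis. (frechet_derivative g (at x) v \<bullet> b) *\<^sub>R b) =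
          (\<Sum>b\<in>Basis. (frechet_derivative g (at x) v \<bullet> b) *\<^sub>R frechet_derivative f (at (g x)) b)"
        by (simp only: bl.sum bl.scaleR)
      then show "(frechet_derivative f (at (g x)) \<circ> frechet_derivative g (at x)) v =
          (\<Sum>b\<in>Basis. (frechet_derivative g (at x) v \<bullet> b) *\<^sub>R frechet_derivative f (at (g x)) b)"
        by (simp only: euclidean_representation o_apply)
    qed
    with diff_chain_at[OF Ck_on_SucD[OF Suc.prems(2) x] df] show ?thesis
      by (simp only: o_def)
  qed
  have "Ck_on k S (\<lambda>x. \<Sum>b\<in>Basis. (frechet_derivative g (at x) v \<bullet> b) *\<^sub>R frechet_derivative f (at (g x)) b)" for v
    using Suc.prems g
    by (intro Ck_on_sum Ck_on_scaleR assms(1) Suc.IH Ck_on_linear_comp[OF bounded_linear_inner_left])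
      auto
  then show ?case using D by (intro Ck_on_SucI[OF assms(1)])
qed

text \<open>Two applications of the mean value theorem express the second difference of \<open>f\<close> over a parallelogram by
  a second derivative at a point of the parallelogram.\<close>

lemma second_difference_mvt:
  fixes f :: "'a::real_normed_vector \<Rightarrow> real"
  assumes S: "open S" and f: "Ck_on 2 S f" and s: "0 < s"
    and sq: "\<And>a b. a \<in> {0..s} \<Longrightarrow> b \<in> {0..s} \<Longrightarrow> z + a *\<^sub>R v + b *\<^sub>R w \<in> S"
  shows "\<exists>a\<in>{0..s}. \<exists>b\<in>{0..s}.
    f (z + s *\<^sub>R v + s *\<^sub>R w) - f (z + s *\<^sub>R v) - f (z + s *\<^sub>R w) + f z =
    s * s * frechet_derivative (\<lambda>x. frechet_derivative f (at x) v) (at (z + a *\<^sub>R v + b *\<^sub>R w)) w"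
proof -
  have f2: "Ck_on (Suc (Suc 0)) S f" using f by (simp add: numeral_2_eq_2)
  then have fv: "Ck_on (Suc 0) S (\<lambda>x. frechet_derivative f (at x) v)" by simp
  have line: "((\<lambda>a. h (q + a *\<^sub>R r)) has_real_derivative frechet_derivative h (at (q + a *\<^sub>R r)) r) (at a)"
    if "Ck_on (Suc k) S h" "q + a *\<^sub>R r \<in> S" for h :: "'a \<Rightarrow> real" and q r a k
  proof -
    note d = Ck_on_SucD[OF that]
    interpret bl: bounded_linear "frechet_derivative h (at (q + a *\<^sub>R r))"
      using d has_derivative_bounded_linear by blast
    have "((\<lambda>a. q + a *\<^sub>R r) has_derivative (\<lambda>t. t *\<^sub>R r)) (at a)"
      by (auto intro!: derivative_eq_intros)
    note diff_chain_at[OF this d]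
    moreover have "frechet_derivative h (at (q + a *\<^sub>R r)) \<circ> (\<lambda>t. t *\<^sub>R r) =
        (*) (frechet_derivative h (at (q + a *\<^sub>R r)) r)"
      by (simp add: fun_eq_iff bl.scaleR)
    ultimately show ?thesis by (simp add: o_def has_field_derivative_def)
  qed
  have swap: "z + s *\<^sub>R w + a *\<^sub>R v = z + a *\<^sub>R v + s *\<^sub>R w" for a
    by (simp add: algebra_simps)
  have "\<exists>a>0. a < s \<and> (f ((z + s *\<^sub>R w) + s *\<^sub>R v) - f (z + s *\<^sub>R v)) - (f ((z + s *\<^sub>R w) + 0 *\<^sub>R v) - f (z + 0 *\<^sub>R v))
     = (s - 0) * (frechet_derivative f (at ((z + s *\<^sub>R w) + a *\<^sub>R v)) v - frechet_derivative f (at (z + a *\<^sub>R v)) v)"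
  proof (rule MVT2[OF s])
    fix a assume "0 \<le> a" "a \<le> s"
    then have "z + s *\<^sub>R w + a *\<^sub>R v \<in> S" "z + a *\<^sub>R v \<in> S"
      using sq[of a s] sq[of a 0] s by (simp_all add: swap)
    then show "((\<lambda>a. f ((z + s *\<^sub>R w) + a *\<^sub>R v) - f (z + a *\<^sub>R v)) has_real_derivative
       (frechet_derivative f (at ((z + s *\<^sub>R w) + a *\<^sub>R v)) v - frechet_derivative f (at (z + a *\<^sub>R v)) v)) (at a)"
      by (intro DERIV_diff line[OF f2])
  qed
  then obtain a where a: "0 < a" "a < s"
    and "(f ((z + s *\<^sub>R w) + s *\<^sub>R v) - f (z + s *\<^sub>R v)) - (f ((z + s *\<^sub>R w) + 0 *\<^sub>R v) - f (z + 0 *\<^sub>R v))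
     = (s - 0) * (frechet_derivative f (at ((z + s *\<^sub>R w) + a *\<^sub>R v)) v - frechet_derivative f (at (z + a *\<^sub>R v)) v)"
    by blast
  then have ea: "f (z + s *\<^sub>R v + s *\<^sub>R w) - f (z + s *\<^sub>R v) - f (z + s *\<^sub>R w) + f z
     = s * (frechet_derivative f (at (z + a *\<^sub>R v + s *\<^sub>R w)) v - frechet_derivative f (at (z + a *\<^sub>R v)) v)"
    by (simp add: swap)
  have "\<exists>b>0. b < s \<and> frechet_derivative f (at ((z + a *\<^sub>R v) + s *\<^sub>R w)) v - frechet_derivative f (at ((z + a *\<^sub>R v) + 0 *\<^sub>R w)) v
     = (s - 0) * frechet_derivative (\<lambda>x. frechet_derivative f (at x) v) (at ((z + a *\<^sub>R v) + b *\<^sub>R w)) w"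
    by (rule MVT2[OF s], rule line[OF fv], rule sq) (use a in auto)
  then obtain b where b: "0 < b" "b < s"
    and eb: "frechet_derivative f (at (z + a *\<^sub>R v + s *\<^sub>R w)) v - frechet_derivative f (at (z + a *\<^sub>R v)) v
     = s * frechet_derivative (\<lambda>x. frechet_derivative f (at x) v) (at (z + a *\<^sub>R v + b *\<^sub>R w)) w"
    by auto
  show ?thesis using a b by (intro bexI[of _ a] bexI[of _ b]) (simp_all add: ea eb)
qed

text \<open>Schwarz's theorem: the second difference is symmetric in \<open>v\<close> and \<open>w\<close>, and the parallelogram may shrink to \<open>z\<close>.\<close>

lemma second_derivative_symmetric:
  fixes f :: "'a::real_normed_vector \<Rightarrow> real"
  assumes S: "open S" and f: "Ck_on 2 S f" and z: "z \<in> S"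
  shows "frechet_derivative (\<lambda>x. frechet_derivative f (at x) v) (at z) w =
    frechet_derivative (\<lambda>x. frechet_derivative f (at x) w) (at z) v"
proof (rule ccontr)
  define P where "P = (\<lambda>x. frechet_derivative (\<lambda>x. frechet_derivative f (at x) v) (at x) w)"
  define Q where "Q = (\<lambda>x. frechet_derivative (\<lambda>x. frechet_derivative f (at x) w) (at x) v)"
  assume "\<not> ?thesis"
  then have ne: "P z \<noteq> Q z" by (simp add: P_def Q_def)
  have "continuous_on S P" "continuous_on S Q"
    using f by (auto simp: P_def Q_def numeral_2_eq_2)
  then have "isCont P z" "isCont Q z"
    using S z by (auto simp: continuous_on_eq_continuous_at)
  define e where "e = \<bar>P z - Q z\<bar> / 2"
  have e: "e > 0" using ne by (simp add: e_def)
  obtain d1 where d1: "d1 > 0" "\<And>x. dist x z < d1 \<Longrightarrow> dist (P x) (P z) < e"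
    using \<open>isCont P z\<close> e by (auto simp: continuous_at_eps_delta)
  obtain d2 where d2: "d2 > 0" "\<And>x. dist x z < d2 \<Longrightarrow> dist (Q x) (Q z) < e"
    using \<open>isCont Q z\<close> e by (auto simp: continuous_at_eps_delta)
  obtain d3 where d3: "d3 > 0" "ball z d3 \<subseteq> S" using S z openE by blast
  define d where "d = Min {d1, d2, d3}"
  have d: "d > 0" using d1 d2 d3 by (simp add: d_def)
  \<comment> \<open>So small that the parallelogram at \<open>z\<close> spanned by \<open>s v\<close> and \<open>s w\<close> lies in \<open>S\<close>.\<close>
  define s where "s = d / (2 * (norm v + norm w + 1))"
  have n0: "norm v + norm w + 1 > 0" by (smt (verit) norm_ge_zero)
  then have s: "s > 0" using d by (simp add: s_def)
  have close: "dist (z + a *\<^sub>R v + b *\<^sub>R w) z < d" if "a \<in> {0..s}" "b \<in> {0..s}" for a b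
  proof -
    have "dist (z + a *\<^sub>R v + b *\<^sub>R w) z = norm (a *\<^sub>R v + b *\<^sub>R w)"
      by (simp add: dist_norm algebra_simps)
    also have "\<dots> \<le> a * norm v + b * norm w"
      using that by (intro order_trans[OF norm_triangle_ineq]) auto
    also have "\<dots> \<le> s * norm v + s * norm w"
      using that by (intro add_mono mult_right_mono) auto
    also have "\<dots> \<le> s * (norm v + norm w + 1)" using s by (simp add: algebra_simps)
    also have "\<dots> = d / 2" using n0 by (simp add: s_def field_simps)
    finally show ?thesis using d by simp
  qed
  have inS: "z + a *\<^sub>R v + b *\<^sub>R w \<in> S" if "a \<in> {0..s}" "b \<in> {0..s}" for a b
    using close[OF that] d3 by (auto simp: d_def dist_commute subset_iff)
  obtain a b where ab: "a \<in> {0..s}" "b \<in> {0..s}"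
    and 1: "f (z + s *\<^sub>R v + s *\<^sub>R w) - f (z + s *\<^sub>R v) - f (z + s *\<^sub>R w) + f z = s * s * P (z + a *\<^sub>R v + b *\<^sub>R w)"
    using second_difference_mvt[OF S f s inS] by (auto simp: P_def)
  have inS': "z + a *\<^sub>R w + b *\<^sub>R v \<in> S" if "a \<in> {0..s}" "b \<in> {0..s}" for a b
    using inS[OF that(2,1)] by (simp add: algebra_simps)
  obtain a' b' where ab': "a' \<in> {0..s}" "b' \<in> {0..s}"
    and 2: "f (z + s *\<^sub>R w + s *\<^sub>R v) - f (z + s *\<^sub>R w) - f (z + s *\<^sub>R v) + f z = s * s * Q (z + a' *\<^sub>R w + b' *\<^sub>R v)"
    using second_difference_mvt[OF S f s inS'] by (auto simp: Q_def)
  have "s * s * P (z + a *\<^sub>R v + b *\<^sub>R w) = s * s * Q (z + a' *\<^sub>R w + b' *\<^sub>R v)"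
    using 1 2 by (simp add: algebra_simps)
  then have "P (z + a *\<^sub>R v + b *\<^sub>R w) = Q (z + b' *\<^sub>R v + a' *\<^sub>R w)"
    using s by (simp add: algebra_simps)
  moreover have "dist (P (z + a *\<^sub>R v + b *\<^sub>R w)) (P z) < e"
    using close[OF ab] by (intro d1) (simp add: d_def)
  moreover have "dist (Q (z + b' *\<^sub>R v + a' *\<^sub>R w)) (Q z) < e"
    using close[OF ab'(2,1)] by (intro d2) (simp add: d_def)
  ultimately show False unfolding e_def dist_real_def
    by (smt (verit) field_sum_of_halves)
qed

section \<open>Smooth functions of position and nonzero fibre coordinate\<close>

text \<open>Functions on the slit tangent bundle over the coordinate domain \<open>\<Omega>\<close>: smoothness is joint smoothness in
  \<open>(x, y)\<close> for \<open>x \<in> \<Omega>\<close>, \<open>y \<noteq> 0\<close>. Values elsewhere are irrelevant.\<close>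

definition slit_smooth :: "(real^2) set \<Rightarrow> local_fun \<Rightarrow> bool" where
  "slit_smooth \<Omega> h \<longleftrightarrow> smooth_on (\<Omega> \<times> - {0}) (\<lambda>(x, y). h x y)"

text \<open>Positive homogeneity of degree \<open>n\<close> in the fibre coordinate, off the zero section.\<close>

definition slit_hom :: "(real^2) set \<Rightarrow> nat \<Rightarrow> local_fun \<Rightarrow> bool" where
  "slit_hom \<Omega> n h \<longleftrightarrow> (\<forall>x\<in>\<Omega>. \<forall>y. y \<noteq> 0 \<longrightarrow> (\<forall>t>0. h x (t *\<^sub>R y) = t ^ n * h x y))"

lemma slit_smooth_iff: "slit_smooth \<Omega> h \<longleftrightarrow> (\<forall>k. Ck_on k (\<Omega> \<times> - {0}) (\<lambda>z. h (fst z) (snd z)))"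
  by (simp add: slit_smooth_def smooth_on_def case_prod_unfold)

lemma slit_homD: "slit_hom \<Omega> n h \<Longrightarrow> x \<in> \<Omega> \<Longrightarrow> y \<noteq> 0 \<Longrightarrow> 0 < t \<Longrightarrow> h x (t *\<^sub>R y) = t ^ n * h x y"
  by (auto simp: slit_hom_def)

lemma deriv_along_line:
  fixes h :: "'a::real_normed_vector \<Rightarrow> real"
  assumes "(h has_derivative D) (at z)"
  shows "((\<lambda>t. h (z + t *\<^sub>R v)) has_real_derivative D v) (at 0)"
proof -
  interpret bl: bounded_linear D using assms has_derivative_bounded_linear by blast
  have "((\<lambda>t. z + t *\<^sub>R v) has_derivative (\<lambda>t. t *\<^sub>R v)) (at 0)"
    by (auto intro!: derivative_eq_intros)
  from diff_chain_at[OF this, of h D] assms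
  have "((\<lambda>t. h (z + t *\<^sub>R v)) has_derivative D \<circ> (\<lambda>t. t *\<^sub>R v)) (at 0)"
    by (simp add: o_def)
  moreover have "D \<circ> (\<lambda>t. t *\<^sub>R v) = (*) (D v)" by (simp add: fun_eq_iff bl.scaleR)
  ultimately show ?thesis by (simp add: has_field_derivative_def)
qed

text \<open>Partial derivatives of smooth functions over an open coordinate domain: they are values of the
  joint Frechet derivative, hence smooth again, and they commute.\<close>

locale base_domain =
  fixes \<Omega> :: "(real^2) set"
  assumes open_base: "open \<Omega>"
begin

lemma open_slit: "open (\<Omega> \<times> - {0 :: real^2})"
  by (intro open_Times open_base open_Compl closed_singleton)

lemma slit_smooth_has_derivative:
  assumes "slit_smooth \<Omega> h" "x \<in> \<Omega>" "y \<noteq> 0"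
  shows "((\<lambda>(x, y). h x y) has_derivative frechet_derivative (\<lambda>(x, y). h x y) (at (x, y))) (at (x, y))"
  by (rule Ck_on_SucD[where k = 0 and S = "\<Omega> \<times> - {0}"])
    (use assms in \<open>auto simp: slit_smooth_def smooth_on_def simp del: Ck_on.simps\<close>)

lemma slit_smooth_has_pdx:
  assumes "slit_smooth \<Omega> h" "x \<in> \<Omega>" "y \<noteq> 0"
  shows "((\<lambda>t. h (x + t *\<^sub>R axis i 1) y) has_real_derivative pdx i h x y) (at 0)"
    and "pdx i h x y = frechet_derivative (\<lambda>(x, y). h x y) (at (x, y)) (axis i 1, 0)"
proof -
  have *: "((\<lambda>t. h (x + t *\<^sub>R axis i 1) y) has_real_derivative
      frechet_derivative (\<lambda>(x, y). h x y) (at (x, y)) (axis i 1, 0)) (at 0)"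
    using deriv_along_line[OF slit_smooth_has_derivative[OF assms], of "(axis i 1, 0)"] by simp
  then show "pdx i h x y = frechet_derivative (\<lambda>(x, y). h x y) (at (x, y)) (axis i 1, 0)"
    unfolding pdx_def by (rule DERIV_imp_deriv)
  with * show "((\<lambda>t. h (x + t *\<^sub>R axis i 1) y) has_real_derivative pdx i h x y) (at 0)" by simp
qed

lemma slit_smooth_has_pdy:
  assumes "slit_smooth \<Omega> h" "x \<in> \<Omega>" "y \<noteq> 0"
  shows "((\<lambda>t. h x (y + t *\<^sub>R axis i 1)) has_real_derivative pdy i h x y) (at 0)"
    and "pdy i h x y = frechet_derivative (\<lambda>(x, y). h x y) (at (x, y)) (0, axis i 1)"
proof -
  have *: "((\<lambda>t. h x (y + t *\<^sub>R axis i 1)) has_real_derivative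
      frechet_derivative (\<lambda>(x, y). h x y) (at (x, y)) (0, axis i 1)) (at 0)"
    using deriv_along_line[OF slit_smooth_has_derivative[OF assms], of "(0, axis i 1)"] by simp
  then show "pdy i h x y = frechet_derivative (\<lambda>(x, y). h x y) (at (x, y)) (0, axis i 1)"
    unfolding pdy_def by (rule DERIV_imp_deriv)
  with * show "((\<lambda>t. h x (y + t *\<^sub>R axis i 1)) has_real_derivative pdy i h x y) (at 0)" by simp
qed

lemma slit_smooth_cong:
  assumes "slit_smooth \<Omega> f" "\<And>x y. x \<in> \<Omega> \<Longrightarrow> y \<noteq> 0 \<Longrightarrow> f x y = g x y"
  shows "slit_smooth \<Omega> g"
  unfolding slit_smooth_iff
proof
  fix k
  show "Ck_on k (\<Omega> \<times> - {0}) (\<lambda>z. g (fst z) (snd z))"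
  proof (rule Ck_on_cong[OF open_slit])
    show "Ck_on k (\<Omega> \<times> - {0}) (\<lambda>z. f (fst z) (snd z))" using assms(1) by (simp only: slit_smooth_iff)
    show "f (fst z) (snd z) = g (fst z) (snd z)" if "z \<in> \<Omega> \<times> - {0}" for z
      using that by (intro assms(2)) auto
  qed
qed

lemma slit_smooth_pdx: assumes "slit_smooth \<Omega> h" shows "slit_smooth \<Omega> (pdx i h)"
  unfolding slit_smooth_iff
proof
  fix k
  have "Ck_on (Suc k) (\<Omega> \<times> - {0}) (\<lambda>(x, y). h x y)" using assms by (simp only: slit_smooth_def smooth_on_def)
  then have "Ck_on k (\<Omega> \<times> - {0}) (\<lambda>z. frechet_derivative (\<lambda>(x, y). h x y) (at z) (axis i 1, 0))" by simp
  then show "Ck_on k (\<Omega> \<times> - {0}) (\<lambda>z. pdx i h (fst z) (snd z))"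
  proof (rule Ck_on_cong[OF open_slit, rotated])
    fix z :: "(real^2) \<times> (real^2)" assume "z \<in> \<Omega> \<times> - {0}"
    then show "frechet_derivative (\<lambda>(x, y). h x y) (at z) (axis i 1, 0) = pdx i h (fst z) (snd z)"
      using slit_smooth_has_pdx(2)[OF assms, of "fst z" "snd z"] by (cases z) simp
  qed
qed

lemma slit_smooth_pdy: assumes "slit_smooth \<Omega> h" shows "slit_smooth \<Omega> (pdy i h)"
  unfolding slit_smooth_iff
proof
  fix k
  have "Ck_on (Suc k) (\<Omega> \<times> - {0}) (\<lambda>(x, y). h x y)" using assms by (simp only: slit_smooth_def smooth_on_def)
  then have "Ck_on k (\<Omega> \<times> - {0}) (\<lambda>z. frechet_derivative (\<lambda>(x, y). h x y) (at z) (0, axis i 1))" by simp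
  then show "Ck_on k (\<Omega> \<times> - {0}) (\<lambda>z. pdy i h (fst z) (snd z))"
  proof (rule Ck_on_cong[OF open_slit, rotated])
    fix z :: "(real^2) \<times> (real^2)" assume "z \<in> \<Omega> \<times> - {0}"
    then show "frechet_derivative (\<lambda>(x, y). h x y) (at z) (0, axis i 1) = pdy i h (fst z) (snd z)"
      using slit_smooth_has_pdy(2)[OF assms, of "fst z" "snd z"] by (cases z) simp
  qed
qed

lemma slit_smooth_const: "slit_smooth \<Omega> (\<lambda>x y. c)"
  by (simp add: slit_smooth_iff Ck_on_const[OF open_slit])

lemma slit_smooth_coord: "slit_smooth \<Omega> (\<lambda>x y. y $ i)"
proof -
  have "bounded_linear (\<lambda>z::(real^2) \<times> (real^2). snd z $ i)"
    by (intro bounded_linear_compose[OF bounded_linear_vec_nth bounded_linear_snd])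
  then show ?thesis
    by (simp add: slit_smooth_iff Ck_on_bounded_linear[OF open_slit])
qed

lemma slit_smooth_add: "slit_smooth \<Omega> f \<Longrightarrow> slit_smooth \<Omega> g \<Longrightarrow> slit_smooth \<Omega> (\<lambda>x y. f x y + g x y)"
  by (simp add: slit_smooth_iff Ck_on_add[OF open_slit])

lemma slit_smooth_mult: "slit_smooth \<Omega> f \<Longrightarrow> slit_smooth \<Omega> g \<Longrightarrow> slit_smooth \<Omega> (\<lambda>x y. f x y * g x y)"
  by (simp add: slit_smooth_iff Ck_on_mult[OF open_slit])

lemma slit_smooth_minus: "slit_smooth \<Omega> f \<Longrightarrow> slit_smooth \<Omega> (\<lambda>x y. - f x y)"
  using slit_smooth_mult[OF slit_smooth_const[of "-1"], of f] by simp

lemma slit_smooth_diff: "slit_smooth \<Omega> f \<Longrightarrow> slit_smooth \<Omega> g \<Longrightarrow> slit_smooth \<Omega> (\<lambda>x y. f x y - g x y)"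
  using slit_smooth_add[OF _ slit_smooth_minus, of f g] by simp

lemma slit_smooth_sum: "(\<And>i. slit_smooth \<Omega> (f i)) \<Longrightarrow> slit_smooth \<Omega> (\<lambda>x y. \<Sum>i\<in>(UNIV::2 set). f i x y)"
  by (simp add: sum_2 slit_smooth_add)

lemma slit_smooth_inverse:
  assumes "slit_smooth \<Omega> f" "\<And>x y. x \<in> \<Omega> \<Longrightarrow> y \<noteq> 0 \<Longrightarrow> f x y \<noteq> 0"
  shows "slit_smooth \<Omega> (\<lambda>x y. inverse (f x y))"
  using Ck_on_inverse[OF open_slit, of "\<lambda>z. f (fst z) (snd z)"] assms
  by (auto simp add: slit_smooth_iff)

lemma slit_smooth_divide:
  assumes "slit_smooth \<Omega> f" "slit_smooth \<Omega> g" "\<And>x y. x \<in> \<Omega> \<Longrightarrow> y \<noteq> 0 \<Longrightarrow> g x y \<noteq> 0"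
  shows "slit_smooth \<Omega> (\<lambda>x y. f x y / g x y)"
  using slit_smooth_mult[OF assms(1) slit_smooth_inverse[OF assms(2,3)]] by (simp add: divide_inverse)

lemma slit_smooth_sqrt:
  assumes "slit_smooth \<Omega> f" "\<And>x y. x \<in> \<Omega> \<Longrightarrow> y \<noteq> 0 \<Longrightarrow> 0 < f x y"
  shows "slit_smooth \<Omega> (\<lambda>x y. sqrt (f x y))"
  using Ck_on_sqrt[OF open_slit, of "\<lambda>z. f (fst z) (snd z)"] assms
  by (auto simp add: slit_smooth_iff)

lemmas slit_smooth_intros = slit_smooth_pdx slit_smooth_pdy slit_smooth_const slit_smooth_coord slit_smooth_add slit_smooth_mult slit_smooth_minus slit_smooth_diff slit_smooth_sum

lemma pdy_cong:
  assumes "x \<in> \<Omega>" "y \<noteq> 0" "\<And>y. y \<noteq> 0 \<Longrightarrow> f x y = g x y"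
  shows "pdy i f x y = pdy i g x y"
proof -
  have "open ((\<lambda>t. y + t *\<^sub>R axis i 1) -` (- {0}))"
    by (intro open_vimage continuous_intros)
  then have "\<forall>\<^sub>F t in nhds 0. y + t *\<^sub>R axis i 1 \<in> - {0}"
    using assms(2) by (auto simp: eventually_nhds)
  then have "\<forall>\<^sub>F t in nhds 0. f x (y + t *\<^sub>R axis i 1) = g x (y + t *\<^sub>R axis i 1)"
    by eventually_elim (use assms(3) in auto)
  then show ?thesis unfolding pdy_def by (rule deriv_cong_ev[OF _ refl])
qed

lemma pdy_add:
  "slit_smooth \<Omega> f \<Longrightarrow> slit_smooth \<Omega> g \<Longrightarrow> x \<in> \<Omega> \<Longrightarrow> y \<noteq> 0 \<Longrightarrow>
    pdy i (\<lambda>x y. f x y + g x y) x y = pdy i f x y + pdy i g x y"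
  by (subst pdy_def) (intro DERIV_imp_deriv DERIV_add slit_smooth_has_pdy)

lemma pdy_diff:
  "slit_smooth \<Omega> f \<Longrightarrow> slit_smooth \<Omega> g \<Longrightarrow> x \<in> \<Omega> \<Longrightarrow> y \<noteq> 0 \<Longrightarrow>
    pdy i (\<lambda>x y. f x y - g x y) x y = pdy i f x y - pdy i g x y"
  by (subst pdy_def) (intro DERIV_imp_deriv DERIV_diff slit_smooth_has_pdy)

lemma pdy_minus:
  "slit_smooth \<Omega> f \<Longrightarrow> x \<in> \<Omega> \<Longrightarrow> y \<noteq> 0 \<Longrightarrow> pdy i (\<lambda>x y. - f x y) x y = - pdy i f x y"
  by (subst pdy_def) (intro DERIV_imp_deriv DERIV_minus slit_smooth_has_pdy)

lemma pdy_mult: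
  "slit_smooth \<Omega> f \<Longrightarrow> slit_smooth \<Omega> g \<Longrightarrow> x \<in> \<Omega> \<Longrightarrow> y \<noteq> 0 \<Longrightarrow>
    pdy i (\<lambda>x y. f x y * g x y) x y = pdy i f x y * g x y + f x y * pdy i g x y"
  by (subst pdy_def, intro DERIV_imp_deriv)
    (auto intro!: derivative_eq_intros slit_smooth_has_pdy simp: mult.commute)

lemma pdy_const: "pdy i (\<lambda>x y. c x) x y = 0"
  by (simp add: pdy_def)

lemma pdy_cmult:
  "slit_smooth \<Omega> g \<Longrightarrow> x \<in> \<Omega> \<Longrightarrow> y \<noteq> 0 \<Longrightarrow> pdy i (\<lambda>x y. c * g x y) x y = c * pdy i g x y"
  by (simp add: pdy_mult slit_smooth_const pdy_const)

lemma pdy_coord: "pdy i (\<lambda>x y. y $ j) x y = (if i = j then 1 else 0)"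
proof -
  have "((\<lambda>t. (y + t *\<^sub>R axis i 1) $ j) has_real_derivative (if i = j then 1 else 0)) (at 0)"
    by (auto intro!: derivative_eq_intros simp: axis_def)
  then show ?thesis unfolding pdy_def by (rule DERIV_imp_deriv)
qed

lemma pdx_mult:
  "slit_smooth \<Omega> f \<Longrightarrow> slit_smooth \<Omega> g \<Longrightarrow> x \<in> \<Omega> \<Longrightarrow> y \<noteq> 0 \<Longrightarrow>
    pdx i (\<lambda>x y. f x y * g x y) x y = pdx i f x y * g x y + f x y * pdx i g x y"
  by (subst pdx_def, intro DERIV_imp_deriv)
    (auto intro!: derivative_eq_intros slit_smooth_has_pdx simp: mult.commute)

lemma pdx_cmult:
  assumes "slit_smooth \<Omega> g" "x \<in> \<Omega>" "y \<noteq> 0"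
  shows "pdx i (\<lambda>x y. c * g x y) x y = c * pdx i g x y"
proof -
  have "pdx i (\<lambda>x y. c) x y = 0" by (simp add: pdx_def)
  then show ?thesis using pdx_mult[OF slit_smooth_const assms, of i c] by simp
qed

lemma frechet_second:
  assumes h: "slit_smooth \<Omega> h" and h': "slit_smooth \<Omega> h'" and xy: "x \<in> \<Omega>" "y \<noteq> 0"
    and eq: "\<And>x y. x \<in> \<Omega> \<Longrightarrow> y \<noteq> 0 \<Longrightarrow> h' x y = frechet_derivative (\<lambda>(x, y). h x y) (at (x, y)) v"
  shows "frechet_derivative (\<lambda>(x, y). h' x y) (at (x, y)) =
    frechet_derivative (\<lambda>z. frechet_derivative (\<lambda>(x, y). h x y) (at z) v) (at (x, y))"
proof (rule frechet_derivative_at[OF has_derivative_transform_within_open[OF slit_smooth_has_derivative[OF h' xy] open_slit]])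
  show "(x, y) \<in> \<Omega> \<times> - {0}" using xy by simp
  fix z :: "(real^2) \<times> (real^2)" assume "z \<in> \<Omega> \<times> - {0}"
  then show "(\<lambda>(x, y). h' x y) z = frechet_derivative (\<lambda>(x, y). h x y) (at z) v"
    using eq[of "fst z" "snd z"] by (cases z) simp
qed

lemma slit_smooth_second_derivative_symmetric:
  assumes "slit_smooth \<Omega> h" "x \<in> \<Omega>" "y \<noteq> 0"
  shows "frechet_derivative (\<lambda>z. frechet_derivative (\<lambda>(x, y). h x y) (at z) v) (at (x, y)) w =
    frechet_derivative (\<lambda>z. frechet_derivative (\<lambda>(x, y). h x y) (at z) w) (at (x, y)) v"
  by (rule second_derivative_symmetric[OF open_slit])
    (use assms in \<open>auto simp: slit_smooth_def smooth_on_def simp del: Ck_on.simps\<close>)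

lemma pd_second:
  assumes "slit_smooth \<Omega> h" "x \<in> \<Omega>" "y \<noteq> 0"
  shows "pdy i (pdy j h) x y = frechet_derivative (\<lambda>z. frechet_derivative (\<lambda>(x, y). h x y)
      (at z) (0, axis j 1)) (at (x, y)) (0, axis i 1)"
    and "pdx i (pdy j h) x y = frechet_derivative (\<lambda>z. frechet_derivative (\<lambda>(x, y). h x y)
      (at z) (0, axis j 1)) (at (x, y)) (axis i 1, 0)"
    and "pdy i (pdx j h) x y = frechet_derivative (\<lambda>z. frechet_derivative (\<lambda>(x, y). h x y)
      (at z) (axis j 1, 0)) (at (x, y)) (0, axis i 1)"
proof -
  note y = frechet_second[OF assms(1) slit_smooth_pdy[OF assms(1), of j] assms(2,3) slit_smooth_has_pdy(2)[OF assms(1), where i = j]]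
  note x = frechet_second[OF assms(1) slit_smooth_pdx[OF assms(1), of j] assms(2,3) slit_smooth_has_pdx(2)[OF assms(1), where i = j]]
  show "pdy i (pdy j h) x y = frechet_derivative (\<lambda>z. frechet_derivative (\<lambda>(x, y). h x y)
      (at z) (0, axis j 1)) (at (x, y)) (0, axis i 1)"
    by (rule trans[OF slit_smooth_has_pdy(2)[OF slit_smooth_pdy[OF assms(1)] assms(2,3)] fun_cong[OF y]])
  show "pdx i (pdy j h) x y = frechet_derivative (\<lambda>z. frechet_derivative (\<lambda>(x, y). h x y)
      (at z) (0, axis j 1)) (at (x, y)) (axis i 1, 0)"
    by (rule trans[OF slit_smooth_has_pdx(2)[OF slit_smooth_pdy[OF assms(1)] assms(2,3)] fun_cong[OF y]])
  show "pdy i (pdx j h) x y = frechet_derivative (\<lambda>z. frechet_derivative (\<lambda>(x, y). h x y)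
      (at z) (axis j 1, 0)) (at (x, y)) (0, axis i 1)"
    by (rule trans[OF slit_smooth_has_pdy(2)[OF slit_smooth_pdx[OF assms(1)] assms(2,3)] fun_cong[OF x]])
qed

lemma pdy_commute:
  assumes "slit_smooth \<Omega> h" "x \<in> \<Omega>" "y \<noteq> 0"
  shows "pdy i (pdy j h) x y = pdy j (pdy i h) x y"
  unfolding pd_second(1)[OF assms] by (rule slit_smooth_second_derivative_symmetric[OF assms])

lemma pdx_pdy_commute:
  assumes "slit_smooth \<Omega> h" "x \<in> \<Omega>" "y \<noteq> 0"
  shows "pdx i (pdy j h) x y = pdy j (pdx i h) x y"
  unfolding pd_second(2,3)[OF assms] by (rule slit_smooth_second_derivative_symmetric[OF assms])

lemma slit_smooth_chain:
  assumes h: "slit_smooth \<Omega> h" and xy: "a t \<in> \<Omega>" "b t \<noteq> 0"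
    and a: "(a has_vector_derivative a') (at t)" and b: "(b has_vector_derivative b') (at t)"
  shows "((\<lambda>t. h (a t) (b t)) has_real_derivative
    (\<Sum>i\<in>UNIV. pdx i h (a t) (b t) * a' $ i + pdy i h (a t) (b t) * b' $ i)) (at t)"
proof -
  let ?D = "frechet_derivative (\<lambda>(x, y). h x y) (at (a t, b t))"
  note d = slit_smooth_has_derivative[OF h xy]
  interpret bl: bounded_linear ?D using d has_derivative_bounded_linear by blast
  have "((\<lambda>t. (a t, b t)) has_derivative (\<lambda>s. (s *\<^sub>R a', s *\<^sub>R b'))) (at t)"
    using has_derivative_Pair a b unfolding has_vector_derivative_def by blast
  from diff_chain_at[OF this d]
  have "((\<lambda>t. h (a t) (b t)) has_derivative ?D \<circ> (\<lambda>s. (s *\<^sub>R a', s *\<^sub>R b'))) (at t)"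
    by (simp add: o_def)
  moreover have "?D \<circ> (\<lambda>s. (s *\<^sub>R a', s *\<^sub>R b')) = (*) (?D (a', b'))"
  proof
    fix s show "(?D \<circ> (\<lambda>s. (s *\<^sub>R a', s *\<^sub>R b'))) s = ?D (a', b') * s"
      using bl.scaleR[of s "(a', b')"] by simp
  qed
  ultimately have 1: "((\<lambda>t. h (a t) (b t)) has_real_derivative ?D (a', b')) (at t)"
    by (simp add: has_field_derivative_def)
  have "a' = (\<Sum>i\<in>UNIV. a' $ i *\<^sub>R axis i 1)" "b' = (\<Sum>i\<in>UNIV. b' $ i *\<^sub>R axis i 1)"
    by (simp_all add: vec_eq_iff sum_2 axis_def forall_2)
  then have "(a', b') = (\<Sum>i\<in>UNIV. a' $ i *\<^sub>R (axis i 1, 0) + b' $ i *\<^sub>R (0, axis i 1))"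
    by (simp add: sum_2)
  then have "?D (a', b') = (\<Sum>i\<in>UNIV. a' $ i * ?D (axis i 1, 0) + b' $ i * ?D (0, axis i 1))"
    by (simp only: bl.sum bl.add bl.scaleR real_scaleR_def)
  then show ?thesis
    using 1 slit_smooth_has_pdx(2)[OF h xy] slit_smooth_has_pdy(2)[OF h xy] by (simp add: mult.commute)
qed

lemma slit_smooth_chain_fibre:
  assumes "slit_smooth \<Omega> h" "x \<in> \<Omega>" "b t \<noteq> 0" "(b has_vector_derivative b') (at t)"
  shows "((\<lambda>t. h x (b t)) has_real_derivative (\<Sum>i\<in>UNIV. pdy i h x (b t) * b' $ i)) (at t)"
  using slit_smooth_chain[OF assms(1), of "\<lambda>_. x", OF assms(2,3) has_vector_derivative_const assms(4)] by simp

lemma slit_smooth_fibre_differentiable: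
  assumes "slit_smooth \<Omega> h" "x \<in> \<Omega>" "y \<noteq> 0"
  shows "h x differentiable (at y)"
proof -
  have "((\<lambda>y. (x, y)) has_derivative (\<lambda>v. (0, v))) (at y)"
    by (auto intro!: derivative_eq_intros)
  from diff_chain_at[OF this slit_smooth_has_derivative[OF assms]] show ?thesis
    by (auto simp: o_def differentiable_def)
qed

lemma slit_smooth_isCont:
  assumes "slit_smooth \<Omega> h" "x \<in> \<Omega>" "y \<noteq> 0"
  shows "isCont (\<lambda>(x, y). h x y) (x, y)"
  using slit_smooth_has_derivative[OF assms] has_derivative_continuous by blast

section \<open>Homogeneity in the fibre coordinate\<close>

lemma slit_hom_mult: "slit_hom \<Omega> m f \<Longrightarrow> slit_hom \<Omega> n g \<Longrightarrow> slit_hom \<Omega> (m + n) (\<lambda>x y. f x y * g x y)"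
  by (simp add: slit_hom_def power_add)

lemma slit_hom_add: "slit_hom \<Omega> n f \<Longrightarrow> slit_hom \<Omega> n g \<Longrightarrow> slit_hom \<Omega> n (\<lambda>x y. f x y + g x y)"
  by (simp add: slit_hom_def algebra_simps)

lemma slit_hom_diff: "slit_hom \<Omega> n f \<Longrightarrow> slit_hom \<Omega> n g \<Longrightarrow> slit_hom \<Omega> n (\<lambda>x y. f x y - g x y)"
  by (simp add: slit_hom_def algebra_simps)

lemma slit_hom_sum: "(\<And>i. slit_hom \<Omega> n (f i)) \<Longrightarrow> slit_hom \<Omega> n (\<lambda>x y. \<Sum>i\<in>(UNIV::2 set). f i x y)"
  by (simp add: sum_2 slit_hom_add)

lemma slit_hom_cmult: "slit_hom \<Omega> n f \<Longrightarrow> slit_hom \<Omega> n (\<lambda>x y. c * f x y)"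
  by (simp add: slit_hom_def)

lemma slit_hom_coord: "slit_hom \<Omega> 1 (\<lambda>x y. y $ i)"
  by (simp add: slit_hom_def)

lemma slit_hom_pdy:
  assumes h: "slit_smooth \<Omega> h" "slit_hom \<Omega> (Suc n) h"
  shows "slit_hom \<Omega> n (pdy i h)"
  unfolding slit_hom_def
proof (intro ballI allI impI)
  fix x and y :: "real^2" and t :: real assume x: "x \<in> \<Omega>" and y: "y \<noteq> 0" and t: "0 < t"
  have 1: "((\<lambda>s. h x (t *\<^sub>R y + s *\<^sub>R axis i 1)) has_real_derivative pdy i h x (t *\<^sub>R y)) (at 0)"
    using slit_smooth_has_pdy(1)[OF h(1) x] y t by simp
  have "((\<lambda>s. h x (y + (s / t) *\<^sub>R axis i 1)) has_real_derivative
      (\<Sum>j\<in>UNIV. pdy j h x (y + (0 / t) *\<^sub>R axis i 1) * (axis i (1 / t) :: real^2) $ j)) (at 0)"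
    by (rule slit_smooth_chain_fibre[OF h(1) x])
      (use y t in \<open>auto intro!: derivative_eq_intros simp: vec_eq_iff axis_def\<close>)
  moreover have "(\<Sum>j\<in>UNIV. pdy j h x (y + (0 / t) *\<^sub>R axis i 1) * (axis i (1 / t) :: real^2) $ j)
      = pdy i h x y / t"
    by (cases i rule: exhaust_2[THEN disjE]) (auto simp: sum_2 axis_def)
  ultimately have "((\<lambda>s. t ^ Suc n * h x (y + (s / t) *\<^sub>R axis i 1)) has_real_derivative
      t ^ Suc n * (pdy i h x y / t)) (at 0)"
    by (intro DERIV_cmult) simp
  then have "((\<lambda>s. h x (t *\<^sub>R y + s *\<^sub>R axis i 1)) has_real_derivative t ^ Suc n * (pdy i h x y / t)) (at 0)"
  proof (rule has_field_derivative_transform_within_open)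
    show "open ((\<lambda>s. y + (s / t) *\<^sub>R axis i 1) -` (- {0}))"
      using t by (intro open_vimage continuous_intros) simp_all
    show "0 \<in> (\<lambda>s. y + (s / t) *\<^sub>R axis i 1) -` (- {0})" using y by simp
    fix s assume "s \<in> (\<lambda>s. y + (s / t) *\<^sub>R axis i 1) -` (- {0})"
    then show "t ^ Suc n * h x (y + (s / t) *\<^sub>R axis i 1) = h x (t *\<^sub>R y + s *\<^sub>R axis i 1)"
      using slit_homD[OF h(2) x, of "y + (s / t) *\<^sub>R axis i 1" t] t by (simp add: scaleR_add_right)
  qed
  then have "pdy i h x (t *\<^sub>R y) = t ^ Suc n * (pdy i h x y / t)"
    using 1 DERIV_unique by blast
  then show "pdy i h x (t *\<^sub>R y) = t ^ n * pdy i h x y" using t by simp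
qed

lemma slit_hom_pdx:
  assumes h: "slit_smooth \<Omega> h" "slit_hom \<Omega> n h"
  shows "slit_hom \<Omega> n (pdx i h)"
  unfolding slit_hom_def
proof (intro ballI allI impI)
  fix x and y :: "real^2" and t :: real assume x: "x \<in> \<Omega>" and y: "y \<noteq> 0" and t: "0 < t"
  have 1: "((\<lambda>s. h (x + s *\<^sub>R axis i 1) (t *\<^sub>R y)) has_real_derivative pdx i h x (t *\<^sub>R y)) (at 0)"
    using slit_smooth_has_pdx(1)[OF h(1) x] y t by simp
  have "((\<lambda>s. t ^ n * h (x + s *\<^sub>R axis i 1) y) has_real_derivative t ^ n * pdx i h x y) (at 0)"
    by (intro DERIV_cmult slit_smooth_has_pdx h x y)
  then have "((\<lambda>s. h (x + s *\<^sub>R axis i 1) (t *\<^sub>R y)) has_real_derivative t ^ n * pdx i h x y) (at 0)"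
  proof (rule has_field_derivative_transform_within_open)
    show "open ((\<lambda>s. x + s *\<^sub>R axis i 1) -` \<Omega>)"
      by (intro open_vimage continuous_intros open_base)
    show "0 \<in> (\<lambda>s. x + s *\<^sub>R axis i 1) -` \<Omega>" using x by simp
  qed (use slit_homD[OF h(2)] y t in auto)
  then show "pdx i h x (t *\<^sub>R y) = t ^ n * pdx i h x y"
    using 1 DERIV_unique by blast
qed

lemma euler:
  assumes h: "slit_smooth \<Omega> h" "slit_hom \<Omega> n h" and x: "x \<in> \<Omega>" and y: "y \<noteq> 0"
  shows "(\<Sum>m\<in>UNIV. y $ m * pdy m h x y) = real n * h x y"
proof -
  have "((\<lambda>t. h x (t *\<^sub>R y)) has_real_derivative (\<Sum>i\<in>UNIV. pdy i h x (1 *\<^sub>R y) * y $ i)) (at 1)"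
    by (rule slit_smooth_chain_fibre[OF h(1) x]) (use y in \<open>auto intro!: derivative_eq_intros\<close>)
  moreover have "((\<lambda>t. h x (t *\<^sub>R y)) has_real_derivative real n * h x y) (at 1)"
  proof (rule has_field_derivative_transform_within_open[of "\<lambda>t. t ^ n * h x y" _ _ "{0<..}"])
    show "((\<lambda>t. t ^ n * h x y) has_real_derivative real n * h x y) (at 1)"
      by (auto intro!: derivative_eq_intros)
  qed (use slit_homD[OF h(2) x y] in auto)
  ultimately show ?thesis using DERIV_unique by (simp add: mult.commute) blast
qed

end

section \<open>Finsler geometry in one chart\<close>

text \<open>If the covectors \<open>b, h\<close> are dual to the vectors \<open>y, v\<close> up to the scale of \<open>b\<close>, then \<open>y, v\<close> is a basis of
  the plane, and \<open>b, h\<close> read off the coefficients.\<close>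

lemma dual_basis_2:
  fixes b h y v w :: "real^2"
  assumes b_y: "(\<Sum>i\<in>UNIV. b $ i * y $ i) = e" "e \<noteq> 0" and bv: "(\<Sum>i\<in>UNIV. b $ i * v $ i) = 0"
    and hy: "(\<Sum>i\<in>UNIV. h $ i * y $ i) = 0" and hv: "(\<Sum>i\<in>UNIV. h $ i * v $ i) = 1"
  shows "w = ((\<Sum>i\<in>UNIV. b $ i * w $ i) / e) *\<^sub>R y + (\<Sum>i\<in>UNIV. h $ i * w $ i) *\<^sub>R v"
proof -
  define p where "p = (\<Sum>i\<in>UNIV. b $ i * w $ i) / e"
  define q where "q = (\<Sum>i\<in>UNIV. h $ i * w $ i)"
  define r where "r = w - p *\<^sub>R y - q *\<^sub>R v"
  have "(\<Sum>i\<in>UNIV. b $ i * r $ i) = (\<Sum>i\<in>UNIV. b $ i * w $ i)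
      - p * (\<Sum>i\<in>UNIV. b $ i * y $ i) - q * (\<Sum>i\<in>UNIV. b $ i * v $ i)"
    by (simp add: r_def sum_2 algebra_simps)
  then have br: "b $ 1 * r $ 1 + b $ 2 * r $ 2 = 0" using b_y bv by (simp add: sum_2 p_def)
  have "(\<Sum>i\<in>UNIV. h $ i * r $ i) = (\<Sum>i\<in>UNIV. h $ i * w $ i)
      - p * (\<Sum>i\<in>UNIV. h $ i * y $ i) - q * (\<Sum>i\<in>UNIV. h $ i * v $ i)"
    by (simp add: r_def sum_2 algebra_simps)
  then have hr: "h $ 1 * r $ 1 + h $ 2 * r $ 2 = 0" using hy hv by (simp add: sum_2 q_def)
  have "(b $ 1 * h $ 2 - b $ 2 * h $ 1) * (y $ 1 * v $ 2 - y $ 2 * v $ 1)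
      = (b $ 1 * y $ 1 + b $ 2 * y $ 2) * (h $ 1 * v $ 1 + h $ 2 * v $ 2)
      - (b $ 1 * v $ 1 + b $ 2 * v $ 2) * (h $ 1 * y $ 1 + h $ 2 * y $ 2)"
    by algebra
  then have nz: "b $ 1 * h $ 2 - b $ 2 * h $ 1 \<noteq> 0" using assms by (auto simp: sum_2)
  have "(b $ 1 * h $ 2 - b $ 2 * h $ 1) * r $ 1 = 0" "(b $ 1 * h $ 2 - b $ 2 * h $ 1) * r $ 2 = 0"
    using br hr by algebra+
  then have "r = 0" using nz by (simp add: vec_eq_iff forall_2)
  then show ?thesis by (simp add: r_def p_def q_def algebra_simps)
qed

lemma matrix_inv_unique:
  fixes X Y :: "real^2^2"
  assumes "X ** Y = mat 1"
  shows "matrix_inv X = Y"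
proof -
  have "Y ** X = mat 1" using assms matrix_left_right_inverse by blast
  then have "X ** matrix_inv X = mat 1 \<and> matrix_inv X ** X = mat 1"
    unfolding matrix_inv_def using assms by (intro someI[of "\<lambda>Z. X ** Z = mat 1 \<and> Z ** X = mat 1" Y]) simp
  then show ?thesis
    by (metis \<open>Y ** X = mat 1\<close> matrix_mul_assoc matrix_mul_lid matrix_mul_rid)
qed

text \<open>The local expression \<open>L\<close> of a Finsler function in one chart. Positivity of \<open>L\<close> itself is not part of
  the hypotheses; only \<open>L \<noteq> 0\<close> off the zero section follows, which is all that is used.\<close>

locale finsler_chart = base_domain +
  fixes L :: local_fun
  assumes slit_smooth_L: "slit_smooth \<Omega> L" and slit_hom_L: "slit_hom \<Omega> 1 L"
    and pos: "x \<in> \<Omega> \<Longrightarrow> y \<noteq> 0 \<Longrightarrow> w \<noteq> 0 \<Longrightarrow> 0 < gprod L x y w w"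
begin

abbreviation "E \<equiv> energy L"

lemma slit_smooth_E: "slit_smooth \<Omega> E"
  using slit_smooth_mult[OF slit_smooth_const[of "1/2"] slit_smooth_mult[OF slit_smooth_L slit_smooth_L]]
  by (simp add: energy_def power2_eq_square)

lemma slit_hom_E: "slit_hom \<Omega> 2 E"
  using slit_hom_L by (simp add: slit_hom_def energy_def power2_eq_square)

lemma slit_smooth_gmat: "slit_smooth \<Omega> (gmat L i j)"
  unfolding gmat_def by (intro slit_smooth_pdy slit_smooth_E)

lemma gmat_sym: "x \<in> \<Omega> \<Longrightarrow> y \<noteq> 0 \<Longrightarrow> gmat L i j x y = gmat L j i x y"
  unfolding gmat_def by (rule pdy_commute[OF slit_smooth_E])

lemma pdy_E: "x \<in> \<Omega> \<Longrightarrow> y \<noteq> 0 \<Longrightarrow> pdy i E x y = L x y * pdy i L x y"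
proof -
  assume xy: "x \<in> \<Omega>" "y \<noteq> 0"
  have "E = (\<lambda>x y. 1/2 * (L x y * L x y))" by (simp add: energy_def power2_eq_square fun_eq_iff)
  then have "pdy i E x y = pdy i (\<lambda>x y. 1/2 * (L x y * L x y)) x y" by (rule arg_cong)
  then show ?thesis
    unfolding pdy_cmult[OF slit_smooth_mult[OF slit_smooth_L slit_smooth_L] xy] pdy_mult[OF slit_smooth_L slit_smooth_L xy] by simp
qed

lemma pdx_E: "x \<in> \<Omega> \<Longrightarrow> y \<noteq> 0 \<Longrightarrow> pdx i E x y = L x y * pdx i L x y"
proof -
  assume xy: "x \<in> \<Omega>" "y \<noteq> 0"
  have "E = (\<lambda>x y. 1/2 * (L x y * L x y))" by (simp add: energy_def power2_eq_square fun_eq_iff)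
  then have "pdx i E x y = pdx i (\<lambda>x y. 1/2 * (L x y * L x y)) x y" by (rule arg_cong)
  then show ?thesis
    unfolding pdx_cmult[OF slit_smooth_mult[OF slit_smooth_L slit_smooth_L] xy] pdx_mult[OF slit_smooth_L slit_smooth_L xy] by simp
qed

lemma euler_E: "x \<in> \<Omega> \<Longrightarrow> y \<noteq> 0 \<Longrightarrow> (\<Sum>m\<in>UNIV. y $ m * pdy m E x y) = (L x y)\<^sup>2"
  using euler[OF slit_smooth_E slit_hom_E] by (simp add: energy_def)

lemma slit_hom_pdy_E: "slit_hom \<Omega> 1 (pdy i E)"
  using slit_hom_pdy[OF slit_smooth_E, of 1 i] slit_hom_E by (simp add: numeral_2_eq_2)

lemma slit_hom_gmat: "slit_hom \<Omega> 0 (gmat L i j)"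
  unfolding gmat_def using slit_hom_pdy[OF slit_smooth_pdy[OF slit_smooth_E], of 0 j i] slit_hom_pdy_E by simp

lemma gmat_y: "x \<in> \<Omega> \<Longrightarrow> y \<noteq> 0 \<Longrightarrow> (\<Sum>m\<in>UNIV. y $ m * gmat L m i x y) = pdy i E x y"
  using euler[OF slit_smooth_pdy[OF slit_smooth_E] slit_hom_pdy_E] by (simp add: gmat_def)

lemma pdy_gmat_y: "x \<in> \<Omega> \<Longrightarrow> y \<noteq> 0 \<Longrightarrow> (\<Sum>m\<in>UNIV. y $ m * pdy i (gmat L m j) x y) = 0"
  using euler[OF slit_smooth_gmat slit_hom_gmat, of x y i j] pdy_commute[OF slit_smooth_pdy[OF slit_smooth_E], of x y i _ j]
  by (simp add: gmat_def)

text \<open>By homogeneity \<open>g(y, y) = L\<^sup>2\<close>.\<close>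

lemma L_nonzero: assumes "x \<in> \<Omega>" "y \<noteq> 0" shows "L x y \<noteq> 0"
proof -
  have "gprod L x y y y = (\<Sum>j\<in>UNIV. y $ j * (\<Sum>i\<in>UNIV. y $ i * gmat L i j x y))"
    by (simp add: gprod_def sum_2 algebra_simps)
  then have "gprod L x y y y = (L x y)\<^sup>2" using gmat_y[OF assms] euler_E[OF assms] by simp
  then show ?thesis using pos[OF assms assms(2)] by auto
qed

text \<open>The determinant of \<open>(g\<^sub>i\<^sub>j)\<close>.\<close>

definition gdet :: local_fun where
  "gdet = (\<lambda>x y. gmat L 1 1 x y * gmat L 2 2 x y - gmat L 1 2 x y * gmat L 2 1 x y)"

lemma gdet_pos: assumes xy: "x \<in> \<Omega>" "y \<noteq> 0" shows "0 < gdet x y"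
proof -
  have "axis 1 1 \<noteq> (0 :: real^2)" by (simp add: axis_eq_0_iff)
  from pos[OF xy this] have g11: "0 < gmat L 1 1 x y" by (simp add: gprod_def sum_2 axis_def)
  \<comment> \<open>For this vector \<open>g(w, w)\<close> is \<open>g\<^sub>1\<^sub>1\<close> times the determinant.\<close>
  define w :: "real^2" where "w = (\<chi> i. if i = 1 then - gmat L 1 2 x y else gmat L 1 1 x y)"
  have "w \<noteq> 0" using g11 by (auto simp: w_def vec_eq_iff forall_2)
  from pos[OF xy this] have "0 < gmat L 1 1 x y * gdet x y"
    by (simp add: gprod_def sum_2 w_def gdet_def gmat_sym[OF xy, of 2 1] algebra_simps)
  then show ?thesis using g11 by (simp add: zero_less_mult_iff)
qed

lemma ginv_explicit:
  assumes xy: "x \<in> \<Omega>" "y \<noteq> 0"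
  shows "ginv L 1 1 x y = gmat L 2 2 x y / gdet x y" "ginv L 1 2 x y = - gmat L 1 2 x y / gdet x y"
    "ginv L 2 1 x y = - gmat L 2 1 x y / gdet x y" "ginv L 2 2 x y = gmat L 1 1 x y / gdet x y"
proof -
  let ?Y = "(\<chi> a b. (if a = 1 then if b = 1 then gmat L 2 2 x y else - gmat L 1 2 x y
     else if b = 1 then - gmat L 2 1 x y else gmat L 1 1 x y) / gdet x y) :: real^2^2"
  have d: "gdet x y \<noteq> 0" using gdet_pos[OF xy] by simp
  have "(\<chi> a b. gmat L a b x y) ** ?Y = mat 1"
    using d by (simp add: vec_eq_iff forall_2 matrix_matrix_mult_def sum_2 mat_def
        flip: add_divide_distrib diff_divide_distrib) (simp add: gdet_def algebra_simps)
  from matrix_inv_unique[OF this]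
  show "ginv L 1 1 x y = gmat L 2 2 x y / gdet x y" "ginv L 1 2 x y = - gmat L 1 2 x y / gdet x y"
    "ginv L 2 1 x y = - gmat L 2 1 x y / gdet x y" "ginv L 2 2 x y = gmat L 1 1 x y / gdet x y"
    by (simp_all add: ginv_def)
qed

lemma gmat_ginv:
  assumes xy: "x \<in> \<Omega>" "y \<noteq> 0"
  shows "(\<Sum>l\<in>UNIV. gmat L m l x y * ginv L l k x y) = (if m = k then 1 else 0)"
proof -
  have d: "gdet x y \<noteq> 0" using gdet_pos[OF xy] by simp
  have "gmat L m 1 x y * ginv L 1 k x y + gmat L m 2 x y * ginv L 2 k x y = (if m = k then 1 else 0)"
    using d exhaust_2[of m] exhaust_2[of k]
    by (auto simp: ginv_explicit[OF xy] simp flip: add_divide_distrib diff_divide_distrib)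
      (simp_all add: gdet_def algebra_simps)
  then show ?thesis by (simp add: sum_2)
qed

lemma slit_smooth_gdet: "slit_smooth \<Omega> gdet"
  unfolding gdet_def by (intro slit_smooth_diff slit_smooth_mult slit_smooth_gmat)

lemma slit_smooth_ginv: "slit_smooth \<Omega> (ginv L i j)"
proof -
  have nz: "x \<in> \<Omega> \<Longrightarrow> y \<noteq> 0 \<Longrightarrow> gdet x y \<noteq> 0" for x y using gdet_pos by force
  have 1: "slit_smooth \<Omega> (\<lambda>x y. gmat L i j x y / gdet x y)" "slit_smooth \<Omega> (\<lambda>x y. - gmat L i j x y / gdet x y)" for i j
    by (intro slit_smooth_divide slit_smooth_gmat slit_smooth_minus slit_smooth_gdet nz; assumption)+
  have "slit_smooth \<Omega> (ginv L 1 1)" by (rule slit_smooth_cong[OF 1(1)[of 2 2]]) (simp add: ginv_explicit)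
  moreover have "slit_smooth \<Omega> (ginv L 2 2)" by (rule slit_smooth_cong[OF 1(1)[of 1 1]]) (simp add: ginv_explicit)
  moreover have "slit_smooth \<Omega> (ginv L 1 2)" by (rule slit_smooth_cong[OF 1(2)[of 1 2]]) (simp add: ginv_explicit)
  moreover have "slit_smooth \<Omega> (ginv L 2 1)" by (rule slit_smooth_cong[OF 1(2)[of 2 1]]) (simp add: ginv_explicit)
  ultimately show ?thesis using exhaust_2[of i] exhaust_2[of j] by auto
qed

lemma slit_hom_ginv: "slit_hom \<Omega> 0 (ginv L i j)"
  using slit_hom_gmat by (simp add: slit_hom_def ginv_def)

lemma slit_smooth_spray: "slit_smooth \<Omega> (spray L l)"
  unfolding spray_def by (intro slit_smooth_intros slit_smooth_ginv slit_smooth_E)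

lemma slit_hom_spray: "slit_hom \<Omega> 2 (spray L l)"
proof -
  have P: "slit_hom \<Omega> 2 (pdx k E)" for k by (intro slit_hom_pdx slit_smooth_E slit_hom_E)
  then have "slit_hom \<Omega> 1 (pdy m (pdx k E))" for m k
    using slit_hom_pdy[OF slit_smooth_pdx[OF slit_smooth_E], of 1] by (simp add: numeral_2_eq_2)
  from slit_hom_mult[OF slit_hom_coord this] have "slit_hom \<Omega> 2 (\<lambda>x y. y $ k * pdy m (pdx k E) x y)" for m k
    by (simp add: numeral_2_eq_2)
  then have "slit_hom \<Omega> 2 (\<lambda>x y. (\<Sum>k\<in>UNIV. y $ k * pdy m (pdx k E) x y) - pdx m E x y)" for m
    by (intro slit_hom_diff slit_hom_sum P)
  from slit_hom_mult[OF slit_hom_ginv this]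
  have "slit_hom \<Omega> 2 (\<lambda>x y. ginv L l m x y * ((\<Sum>k\<in>UNIV. y $ k * pdy m (pdx k E) x y) - pdx m E x y))" for m
    by (simp only: add_0)
  then show ?thesis unfolding spray_def by (intro slit_hom_cmult slit_hom_sum)
qed

lemma slit_smooth_spray1: "slit_smooth \<Omega> (spray1 L l i)" and slit_smooth_spray2: "slit_smooth \<Omega> (spray2 L l i j)"
  and slit_smooth_spray3: "slit_smooth \<Omega> (spray3 L l i j k)"
  unfolding spray1_def spray2_def spray3_def by (intro slit_smooth_pdy slit_smooth_spray)+

lemma slit_hom_spray1: "slit_hom \<Omega> 1 (spray1 L l i)"
  unfolding spray1_def using slit_hom_pdy[OF slit_smooth_spray, of 1] slit_hom_spray by (simp add: numeral_2_eq_2)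

text \<open>The defining equation of the spray, with \<open>g\<close> moved to the left hand side.\<close>

lemma spray_equation:
  assumes xy: "x \<in> \<Omega>" "y \<noteq> 0"
  shows "2 * (\<Sum>l\<in>UNIV. gmat L m l x y * spray L l x y) =
    (\<Sum>k\<in>UNIV. y $ k * pdy m (pdx k E) x y) - pdx m E x y"
proof -
  define B where "B = (\<lambda>m. (\<Sum>k\<in>UNIV. y $ k * pdy m (pdx k E) x y) - pdx m E x y)"
  have sp: "spray L l x y = 1/2 * (\<Sum>m\<in>UNIV. ginv L l m x y * B m)" for l
    by (simp only: spray_def B_def)
  have "2 * (\<Sum>l\<in>UNIV. gmat L m l x y * spray L l x y)
      = (\<Sum>n\<in>UNIV. (\<Sum>l\<in>UNIV. gmat L m l x y * ginv L l n x y) * B n)"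
    by (simp add: sp sum_2 algebra_simps)
  also have "\<dots> = B m" using exhaust_2[of m] by (auto simp: gmat_ginv[OF xy] sum_2)
  finally show ?thesis by (simp add: B_def)
qed

lemmas slit_smooth_all = slit_smooth_intros slit_smooth_E slit_smooth_gmat slit_smooth_spray slit_smooth_spray1 slit_smooth_spray2 slit_smooth_spray3 slit_smooth_L
lemmas pdy_rules = pdy_add pdy_diff pdy_mult pdy_minus pdy_const pdy_coord

text \<open>The canonical horizontal sections annihilate the energy. This follows by differentiating
  \<open>spray_equation\<close> by \<open>y\<^sup>i\<close> and contracting with \<open>y\<^sup>m\<close>; all terms are then evaluated by Euler's relation.\<close>

lemma horizontal_energy:
  assumes xy: "x \<in> \<Omega>" "y \<noteq> 0"
  shows "pdx i E x y = (\<Sum>l\<in>UNIV. spray1 L l i x y * pdy l E x y)"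
proof -
  \<comment> \<open>The derivative of the spray equation by \<open>y\<^sup>i\<close>.\<close>
  have D: "2 * (\<Sum>l\<in>UNIV. pdy i (gmat L m l) x y * spray L l x y + gmat L m l x y * spray1 L l i x y)
     = pdy m (pdx i E) x y + (\<Sum>k\<in>UNIV. y $ k * pdy i (pdy m (pdx k E)) x y) - pdy i (pdx m E) x y" for m
  proof -
    have "pdy i (\<lambda>x y. 2 * (\<Sum>l\<in>UNIV. gmat L m l x y * spray L l x y)) x y =
       pdy i (\<lambda>x y. (\<Sum>k\<in>UNIV. y $ k * pdy m (pdx k E) x y) - pdx m E x y) x y"
      by (rule pdy_cong[OF xy]) (rule spray_equation[OF xy(1)])
    then show ?thesis using exhaust_2[of i]
      by (auto simp: sum_2 pdy_rules slit_smooth_all xy spray1_def)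
  qed
  have P: "(\<Sum>m\<in>UNIV. y $ m * pdy m (pdx k E) x y) = 2 * pdx k E x y" if "y \<noteq> 0" for k y
    using euler[OF slit_smooth_pdx[OF slit_smooth_E] slit_hom_pdx[OF slit_smooth_E slit_hom_E] xy(1) that, of k] by simp
  \<comment> \<open>The derivative by \<open>y\<^sup>i\<close> of Euler's relation for \<open>\<partial>E/\<partial>x\<^sup>k\<close>.\<close>
  have P2: "(\<Sum>m\<in>UNIV. y $ m * pdy i (pdy m (pdx k E)) x y) = pdy i (pdx k E) x y" for k
  proof -
    have "pdy i (\<lambda>x y. \<Sum>m\<in>UNIV. y $ m * pdy m (pdx k E) x y) x y = pdy i (\<lambda>x y. 2 * pdx k E x y) x y"
      by (rule pdy_cong[OF xy]) (rule P)
    then show ?thesis using exhaust_2[of i]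
      by (auto simp: sum_2 pdy_rules slit_smooth_all xy)
  qed
  have "(\<Sum>m\<in>UNIV. y $ m * (2 * (\<Sum>l\<in>UNIV. pdy i (gmat L m l) x y * spray L l x y + gmat L m l x y * spray1 L l i x y)))
     = 2 * (\<Sum>l\<in>UNIV. (\<Sum>m\<in>UNIV. y $ m * pdy i (gmat L m l) x y) * spray L l x y)
     + 2 * (\<Sum>l\<in>UNIV. spray1 L l i x y * (\<Sum>m\<in>UNIV. y $ m * gmat L m l x y))"
    by (simp add: sum_2 algebra_simps)
  also have "\<dots> = 2 * (\<Sum>l\<in>UNIV. spray1 L l i x y * pdy l E x y)"
    by (simp add: pdy_gmat_y[OF xy] gmat_y[OF xy])
  finally have "2 * (\<Sum>l\<in>UNIV. spray1 L l i x y * pdy l E x y) =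
    (\<Sum>m\<in>UNIV. y $ m * (pdy m (pdx i E) x y + (\<Sum>k\<in>UNIV. y $ k * pdy i (pdy m (pdx k E)) x y) - pdy i (pdx m E) x y))"
    by (simp only: D)
  also have "\<dots> = (\<Sum>m\<in>UNIV. y $ m * pdy m (pdx i E) x y)
      + (\<Sum>k\<in>UNIV. y $ k * (\<Sum>m\<in>UNIV. y $ m * pdy i (pdy m (pdx k E)) x y))
      - (\<Sum>m\<in>UNIV. y $ m * pdy i (pdx m E) x y)"
    by (simp add: sum_2 algebra_simps)
  also have "\<dots> = 2 * pdx i E x y"
    by (simp add: P[OF xy(2)] P2)
  finally show ?thesis by simp
qed

text \<open>The relation \<open>2 P\<^sub>i\<^sub>j\<^sub>k = G\<^sup>l\<^sub>i\<^sub>j\<^sub>k \<partial>E/\<partial>y\<^sup>l\<close>, obtained by differentiating \<open>horizontal_energy\<close> by \<open>y\<^sup>j\<close> and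
  \<open>y\<^sup>k\<close>. On the indicatrix \<open>\<partial>E/\<partial>y\<^sup>l = \<partial>L/\<partial>y\<^sup>l\<close>.\<close>

lemma landsberg_low_eq:
  assumes xy: "x \<in> \<Omega>" "y \<noteq> 0"
  shows "2 * landsberg_low L i j k x y = (\<Sum>l\<in>UNIV. spray3 L l i j k x y * pdy l E x y)"
proof -
  have 1: "pdy j (pdx i E) x y = (\<Sum>l\<in>UNIV. spray2 L l i j x y * pdy l E x y + spray1 L l i x y * gmat L j l x y)"
    if y: "y \<noteq> 0" for y
  proof -
    have "pdy j (pdx i E) x y = pdy j (\<lambda>x y. \<Sum>l\<in>UNIV. spray1 L l i x y * pdy l E x y) x y"
      by (rule pdy_cong[OF xy(1) y]) (rule horizontal_energy[OF xy(1)])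
    then show ?thesis by (simp add: sum_2 pdy_rules slit_smooth_all xy y spray2_def gmat_def)
  qed
  have 2: "pdy k (pdy j (pdx i E)) x y = (\<Sum>l\<in>UNIV. spray3 L l i j k x y * pdy l E x y + spray2 L l i j x y * gmat L k l x y
      + spray2 L l i k x y * gmat L j l x y + spray1 L l i x y * pdy k (gmat L j l) x y)"
  proof -
    have "pdy k (pdy j (pdx i E)) x y = pdy k (\<lambda>x y. \<Sum>l\<in>UNIV. spray2 L l i j x y * pdy l E x y + spray1 L l i x y * gmat L j l x y) x y"
      by (rule pdy_cong[OF xy]) (rule 1)
    then show ?thesis
      by (simp add: sum_2 pdy_rules slit_smooth_all xy spray3_def spray2_def[of L _ i k] gmat_def[of L k])
  qed
  have 3: "pdx i (gmat L j k) x y = pdy k (pdy j (pdx i E)) x y"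
  proof -
    have "pdx i (gmat L j k) x y = pdy j (pdx i (pdy k E)) x y"
      unfolding gmat_def by (rule pdx_pdy_commute[OF slit_smooth_pdy[OF slit_smooth_E] xy])
    also have "\<dots> = pdy j (pdy k (pdx i E)) x y"
      by (rule pdy_cong[OF xy]) (rule pdx_pdy_commute[OF slit_smooth_E xy(1)])
    also have "\<dots> = pdy k (pdy j (pdx i E)) x y"
      by (rule pdy_commute[OF slit_smooth_pdx[OF slit_smooth_E] xy])
    finally show ?thesis .
  qed
  \<comment> \<open>Total symmetry of the Cartan tensor.\<close>
  have 4: "pdy l (gmat L j k) x y = pdy k (gmat L j l) x y" for l
  proof -
    have "pdy l (pdy k (pdy j E)) x y = pdy k (pdy l (pdy j E)) x y"
      by (rule pdy_commute[OF slit_smooth_pdy[OF slit_smooth_E] xy])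
    moreover have "pdy a (gmat L j b) x y = pdy a (pdy b (pdy j E)) x y" for a b
      unfolding gmat_def by (rule pdy_cong[OF xy]) (rule pdy_commute[OF slit_smooth_E xy(1)])
    ultimately show ?thesis by simp
  qed
  define B where "B = (\<lambda>m. hderiv L i (gmat L j m) x y
      - (\<Sum>k\<in>UNIV. spray2 L k i j x y * gmat L k m x y) - (\<Sum>k\<in>UNIV. spray2 L k i m x y * gmat L j k x y))"
  have la: "landsberg L l i j x y = 1/2 * (\<Sum>m\<in>UNIV. ginv L l m x y * B m)" for l
    by (simp only: landsberg_def B_def)
  have "2 * landsberg_low L i j k x y = (\<Sum>m\<in>UNIV. (\<Sum>l\<in>UNIV. gmat L k l x y * ginv L l m x y) * B m)"
    by (simp add: landsberg_low_def la sum_2 algebra_simps)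
  also have "\<dots> = B k" using exhaust_2[of k] by (auto simp: gmat_ginv[OF xy] sum_2)
  also have "B k = (\<Sum>l\<in>UNIV. spray3 L l i j k x y * pdy l E x y)"
    by (simp add: B_def hderiv_def 3 2 4 sum_2 gmat_sym[OF xy, of _ k] algebra_simps)
  finally show ?thesis .
qed

lemma alpha_eq:
  assumes "x \<in> \<Omega>" "y \<noteq> 0"
  shows "2 * alpha L i x y = (\<Sum>l\<in>UNIV. pdy l E x y *
    (\<Sum>j\<in>UNIV. \<Sum>k\<in>UNIV. spray3 L l i j k x y * V0 L x y $ j * V0 L x y $ k))"
proof -
  have "2 * alpha L i x y = (\<Sum>j\<in>UNIV. \<Sum>k\<in>UNIV. V0 L x y $ j * V0 L x y $ k * (2 * landsberg_low L i j k x y))"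
    by (simp add: alpha_def sum_2 algebra_simps)
  also have "\<dots> = (\<Sum>l\<in>UNIV. pdy l E x y * (\<Sum>j\<in>UNIV. \<Sum>k\<in>UNIV. spray3 L l i j k x y * V0 L x y $ j * V0 L x y $ k))"
    unfolding landsberg_low_eq[OF assms] by (simp add: sum_2 algebra_simps)
  finally show ?thesis .
qed

end

section \<open>The central affine frame of the indicatrix\<close>

context finsler_chart
begin

lemma Vfield_nth: "Vfield L x y $ 1 = - pdy 2 L x y" "Vfield L x y $ 2 = pdy 1 L x y"
  by (simp_all add: Vfield_def axis_def)

lemma gprod_Vfield_pos:
  assumes xy: "x \<in> \<Omega>" "y \<noteq> 0"
  shows "0 < gprod L x y (Vfield L x y) (Vfield L x y)"
proof -
  have "(\<Sum>m\<in>UNIV. y $ m * pdy m L x y) = L x y"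
    using euler[OF slit_smooth_L slit_hom_L xy] by simp
  then have "Vfield L x y \<noteq> 0"
    using L_nonzero[OF xy] by (auto simp: vec_eq_iff forall_2 Vfield_nth sum_2)
  then show ?thesis using pos[OF xy] by blast
qed

lemma Vnorm_pos: "x \<in> \<Omega> \<Longrightarrow> y \<noteq> 0 \<Longrightarrow> 0 < Vnorm L x y"
  by (simp add: Vnorm_def gprod_Vfield_pos)

lemma slit_smooth_Vfield: "slit_smooth \<Omega> (\<lambda>x y. Vfield L x y $ j)"
  using exhaust_2[of j] by (auto simp: Vfield_nth slit_smooth_all)

lemma slit_smooth_Vnorm: "slit_smooth \<Omega> (Vnorm L)"
  unfolding Vnorm_def
  by (intro slit_smooth_sqrt gprod_Vfield_pos) (auto simp: gprod_def intro!: slit_smooth_intros slit_smooth_gmat slit_smooth_Vfield)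

lemma V0_nth: "V0 L x y $ j = Vfield L x y $ j / Vnorm L x y"
  by (simp add: V0_def)

lemma slit_smooth_V0: "slit_smooth \<Omega> (\<lambda>x y. V0 L x y $ j)"
  unfolding V0_nth by (intro slit_smooth_divide slit_smooth_Vfield slit_smooth_Vnorm) (use Vnorm_pos in force)

lemma V0_tangent:
  assumes "x \<in> \<Omega>" "y \<noteq> 0"
  shows "(\<Sum>l\<in>UNIV. pdy l E x y * V0 L x y $ l) = 0"
  by (simp add: sum_2 V0_nth Vfield_nth pdy_E[OF assms])

lemma V0_unit:
  assumes xy: "x \<in> \<Omega>" "y \<noteq> 0"
  shows "(\<Sum>i\<in>UNIV. \<Sum>j\<in>UNIV. gmat L i j x y * V0 L x y $ i * V0 L x y $ j) = 1"
proof -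
  have "(Vnorm L x y)\<^sup>2 = gprod L x y (Vfield L x y) (Vfield L x y)"
    using gprod_Vfield_pos[OF xy] by (simp add: Vnorm_def)
  moreover have "gprod L x y (V0 L x y) (V0 L x y)
      = gprod L x y (Vfield L x y) (Vfield L x y) / (Vnorm L x y)\<^sup>2"
    by (simp add: gprod_def sum_2 V0_nth power2_eq_square add_divide_distrib)
  ultimately show ?thesis
    using gprod_Vfield_pos[OF xy] by (simp add: gprod_def)
qed

text \<open>The covector \<open>g(V\<^sub>0, \<cdot>)\<close>. Together with \<open>dE\<close> it is, up to scale, the dual frame of \<open>y, V\<^sub>0\<close>.\<close>

definition V0_covector :: "real^2 \<Rightarrow> real^2 \<Rightarrow> real^2" where
  "V0_covector x y = (\<chi> l. \<Sum>j\<in>UNIV. gmat L j l x y * V0 L x y $ j)"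

lemma V0_covector_y:
  assumes xy: "x \<in> \<Omega>" "y \<noteq> 0"
  shows "(\<Sum>l\<in>UNIV. V0_covector x y $ l * y $ l) = 0"
proof -
  have "(\<Sum>l\<in>UNIV. V0_covector x y $ l * y $ l) = (\<Sum>j\<in>UNIV. (\<Sum>l\<in>UNIV. y $ l * gmat L l j x y) * V0 L x y $ j)"
    by (simp add: V0_covector_def sum_2 gmat_sym[OF xy, of 2 1] algebra_simps)
  then show ?thesis by (simp add: gmat_y[OF xy] V0_tangent[OF xy])
qed

lemma V0_covector_V0:
  assumes "x \<in> \<Omega>" "y \<noteq> 0"
  shows "(\<Sum>l\<in>UNIV. V0_covector x y $ l * V0 L x y $ l) = 1"
  using V0_unit[OF assms] by (simp add: V0_covector_def sum_2 algebra_simps)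

lemma frame_decomposition:
  assumes xy: "x \<in> \<Omega>" "y \<noteq> 0"
  shows "w = ((\<Sum>l\<in>UNIV. pdy l E x y * w $ l) / (L x y)\<^sup>2) *\<^sub>R y
    + (\<Sum>l\<in>UNIV. V0_covector x y $ l * w $ l) *\<^sub>R V0 L x y"
  using dual_basis_2[of "\<chi> l. pdy l E x y" y "(L x y)\<^sup>2" "V0 L x y" "V0_covector x y" w]
    euler_E[OF xy] L_nonzero[OF xy] V0_tangent[OF xy] V0_covector_y[OF xy] V0_covector_V0[OF xy]
  by (simp add: mult.commute)

text \<open>The derivative of a function along the vertical vector field \<open>V\<^sub>0\<close>.\<close>

definition dV :: "local_fun \<Rightarrow> local_fun" where
  "dV h = (\<lambda>x y. \<Sum>j\<in>UNIV. pdy j h x y * V0 L x y $ j)"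

lemma slit_smooth_dV: "slit_smooth \<Omega> h \<Longrightarrow> slit_smooth \<Omega> (dV h)"
  unfolding dV_def by (intro slit_smooth_sum slit_smooth_mult slit_smooth_pdy slit_smooth_V0)

lemma slit_smooth_main_scalar: "slit_smooth \<Omega> (main_scalar L)"
  unfolding main_scalar_def cartan_def by (intro slit_smooth_intros slit_smooth_gmat slit_smooth_V0)

text \<open>On the indicatrix \<open>L = 1\<close> this is the structure equation \<open>c'' = - \<lambda> c' - c\<close> of the central affine
  parametrization: the \<open>y\<close>-component comes from differentiating \<open>dE(V\<^sub>0) = 0\<close> along \<open>V\<^sub>0\<close>, the
  \<open>V\<^sub>0\<close>-component from differentiating \<open>g(V\<^sub>0, V\<^sub>0) = 1\<close>.\<close>

lemma dV_V0:
  assumes xy: "x \<in> \<Omega>" "y \<noteq> 0"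
  shows "dV (\<lambda>x y. V0 L x y $ l) x y = - y $ l / (L x y)\<^sup>2 - main_scalar L x y * V0 L x y $ l"
proof -
  define w :: "real^2" where "w = (\<chi> l. dV (\<lambda>x y. V0 L x y $ l) x y)"
  have "(\<Sum>l\<in>UNIV. pdy k (\<lambda>x y. V0 L x y $ l) x y * pdy l E x y + V0 L x y $ l * gmat L k l x y) = 0" for k
  proof -
    have "pdy k (\<lambda>x y. \<Sum>l\<in>UNIV. V0 L x y $ l * pdy l E x y) x y = pdy k (\<lambda>x y. 0) x y"
      by (rule pdy_cong[OF xy]) (use V0_tangent[OF xy(1)] in \<open>simp add: mult.commute\<close>)
    then show ?thesis by (simp add: sum_2 pdy_rules slit_smooth_all slit_smooth_V0 xy gmat_def)
  qed
  then have "(\<Sum>k\<in>UNIV. V0 L x y $ k *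
      (\<Sum>l\<in>UNIV. pdy k (\<lambda>x y. V0 L x y $ l) x y * pdy l E x y + V0 L x y $ l * gmat L k l x y)) = 0"
    by simp
  then have "(\<Sum>l\<in>UNIV. pdy l E x y * w $ l)
      + (\<Sum>i\<in>UNIV. \<Sum>j\<in>UNIV. gmat L i j x y * V0 L x y $ i * V0 L x y $ j) = 0"
    by (simp add: w_def dV_def sum_2 algebra_simps)
  then have Ew: "(\<Sum>l\<in>UNIV. pdy l E x y * w $ l) = - 1" using V0_unit[OF xy] by simp
  have "(\<Sum>i\<in>UNIV. \<Sum>j\<in>UNIV. pdy k (gmat L i j) x y * V0 L x y $ i * V0 L x y $ j
      + gmat L i j x y * pdy k (\<lambda>x y. V0 L x y $ i) x y * V0 L x y $ j
      + gmat L i j x y * V0 L x y $ i * pdy k (\<lambda>x y. V0 L x y $ j) x y) = 0" for k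
  proof -
    have "pdy k (\<lambda>x y. \<Sum>i\<in>UNIV. \<Sum>j\<in>UNIV. gmat L i j x y * V0 L x y $ i * V0 L x y $ j) x y = pdy k (\<lambda>x y. 1) x y"
      by (rule pdy_cong[OF xy]) (rule V0_unit[OF xy(1)])
    then show ?thesis by (simp add: sum_2 pdy_rules slit_smooth_all slit_smooth_V0 xy algebra_simps)
  qed
  then have "(\<Sum>k\<in>UNIV. V0 L x y $ k * (\<Sum>i\<in>UNIV. \<Sum>j\<in>UNIV. pdy k (gmat L i j) x y * V0 L x y $ i * V0 L x y $ j
      + gmat L i j x y * pdy k (\<lambda>x y. V0 L x y $ i) x y * V0 L x y $ j
      + gmat L i j x y * V0 L x y $ i * pdy k (\<lambda>x y. V0 L x y $ j) x y)) = 0"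
    by simp
  then have "2 * main_scalar L x y + 2 * (\<Sum>l\<in>UNIV. V0_covector x y $ l * w $ l) = 0"
    by (simp add: main_scalar_def cartan_def V0_covector_def w_def dV_def sum_2 gmat_sym[OF xy, of 2 1]
        algebra_simps)
  then have Hw: "(\<Sum>l\<in>UNIV. V0_covector x y $ l * w $ l) = - main_scalar L x y" by simp
  have "w $ l = - y $ l / (L x y)\<^sup>2 - main_scalar L x y * V0 L x y $ l"
    by (subst frame_decomposition[OF xy, of w]) (simp add: Ew Hw)
  then show ?thesis by (simp add: w_def)
qed

section \<open>The connection along an indicatrix\<close>

text \<open>For constants \<open>\<Gamma> l i j\<close>, to be thought of as the coefficients \<open>\<Gamma>\<^sub>i\<^sub>j\<^sup>l\<close> at one fixed point, \<open>conn_diff \<Gamma> i l\<close> is the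
  \<open>l\<close>-th component of \<open>D\<^sub>i\<close>, the horizontal lift of \<open>\<partial>/\<partial>u\<^sup>i\<close> given by the spray minus the one given by \<open>\<Gamma>\<close>.\<close>

definition conn_diff :: "(2 \<Rightarrow> 2 \<Rightarrow> 2 \<Rightarrow> real) \<Rightarrow> 2 \<Rightarrow> 2 \<Rightarrow> local_fun" where
  "conn_diff \<Gamma> i l = (\<lambda>x y. (\<Sum>j\<in>UNIV. \<Gamma> l i j * y $ j) - spray1 L l i x y)"

text \<open>The \<open>V\<^sub>0\<close>-component of \<open>D\<^sub>i\<close>.\<close>

definition conn_phi :: "(2 \<Rightarrow> 2 \<Rightarrow> 2 \<Rightarrow> real) \<Rightarrow> 2 \<Rightarrow> local_fun" where
  "conn_phi \<Gamma> i = (\<lambda>x y. \<Sum>l\<in>UNIV. V0_covector x y $ l * conn_diff \<Gamma> i l x y)"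

text \<open>The horizontal lifts given by \<open>\<Gamma>\<close> annihilate the energy over the point \<open>x\<close>; this is what
  compatibility of a linear connection amounts to.\<close>

definition preserves_energy :: "(2 \<Rightarrow> 2 \<Rightarrow> 2 \<Rightarrow> real) \<Rightarrow> real^2 \<Rightarrow> bool" where
  "preserves_energy \<Gamma> x \<longleftrightarrow> (\<forall>i y. y \<noteq> 0 \<longrightarrow>
     pdx i E x y = (\<Sum>l\<in>UNIV. (\<Sum>j\<in>UNIV. \<Gamma> l i j * y $ j) * pdy l E x y))"

lemma slit_smooth_conn_diff: "slit_smooth \<Omega> (conn_diff \<Gamma> i l)"
  unfolding conn_diff_def by (intro slit_smooth_all)

lemma pdy_conn_diff:
  assumes "x \<in> \<Omega>" "y \<noteq> 0"
  shows "pdy j (conn_diff \<Gamma> i l) x y = \<Gamma> l i j - spray2 L l i j x y"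
  using exhaust_2[of j] by (auto simp: conn_diff_def spray2_def sum_2 pdy_rules slit_smooth_all assms)

lemma slit_hom_conn_diff: "slit_hom \<Omega> 1 (conn_diff \<Gamma> i l)"
  unfolding conn_diff_def by (intro slit_hom_diff slit_hom_sum slit_hom_cmult slit_hom_coord slit_hom_spray1)

lemma slit_smooth_conn_phi: "slit_smooth \<Omega> (conn_phi \<Gamma> i)"
  unfolding conn_phi_def V0_covector_def vec_lambda_beta by (intro slit_smooth_all slit_smooth_V0 slit_smooth_conn_diff)

lemma slit_hom_pdy_L: "slit_hom \<Omega> 0 (pdy i L)"
  using slit_hom_pdy[OF slit_smooth_L, of 0] slit_hom_L by simp

lemma slit_hom_Vnorm: "slit_hom \<Omega> 0 (Vnorm L)"
  using slit_hom_gmat slit_hom_pdy_L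
  by (simp add: slit_hom_def Vnorm_def gprod_def sum_2 Vfield_nth)

lemma slit_hom_V0: "slit_hom \<Omega> 0 (\<lambda>x y. V0 L x y $ j)"
  using slit_hom_Vnorm slit_hom_pdy_L exhaust_2[of j] by (auto simp: slit_hom_def V0_nth Vfield_nth)

lemma slit_hom_conn_phi: "slit_hom \<Omega> 1 (conn_phi \<Gamma> i)"
  using slit_hom_gmat slit_hom_V0 slit_hom_conn_diff
  by (simp add: slit_hom_def conn_phi_def V0_covector_def sum_2 algebra_simps)

text \<open>Both horizontal lifts annihilate the energy, hence so does \<open>D\<^sub>i\<close>, which leaves no \<open>y\<close>-component.\<close>

lemma conn_diff_eq:
  assumes \<Gamma>: "preserves_energy \<Gamma> x" and xy: "x \<in> \<Omega>" "y \<noteq> 0"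
  shows "conn_diff \<Gamma> i l x y = conn_phi \<Gamma> i x y * V0 L x y $ l"
proof -
  define w :: "real^2" where "w = (\<chi> l. conn_diff \<Gamma> i l x y)"
  have "(\<Sum>l\<in>UNIV. pdy l E x y * w $ l) =
      (\<Sum>l\<in>UNIV. (\<Sum>j\<in>UNIV. \<Gamma> l i j * y $ j) * pdy l E x y) - (\<Sum>l\<in>UNIV. spray1 L l i x y * pdy l E x y)"
    by (simp add: w_def conn_diff_def sum_2 algebra_simps)
  also have "\<dots> = 0"
    using \<Gamma> xy horizontal_energy[OF xy] by (simp add: preserves_energy_def)
  finally have "w $ l = conn_phi \<Gamma> i x y * V0 L x y $ l"
    by (subst frame_decomposition[OF xy, of w]) (simp add: conn_phi_def w_def)
  then show ?thesis by (simp add: w_def)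
qed

text \<open>The function \<open>f\<^sub>i\<close> of the theorem, the coefficient of \<open>D\<^sub>i\<close> with respect to \<open>V = sqrt (g(V, V)) V\<^sub>0\<close>.\<close>

definition conn_f :: "(2 \<Rightarrow> 2 \<Rightarrow> 2 \<Rightarrow> real) \<Rightarrow> 2 \<Rightarrow> local_fun" where
  "conn_f \<Gamma> i = (\<lambda>x y. conn_phi \<Gamma> i x y / Vnorm L x y)"

lemma slit_smooth_conn_f: "slit_smooth \<Omega> (conn_f \<Gamma> i)"
  unfolding conn_f_def by (intro slit_smooth_divide slit_smooth_conn_phi slit_smooth_Vnorm) (use Vnorm_pos in force)

lemma slit_hom_conn_f: "slit_hom \<Omega> 1 (conn_f \<Gamma> i)"
  using slit_hom_conn_phi slit_hom_Vnorm by (simp add: slit_hom_def conn_f_def)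

lemma connection_formula:
  assumes \<Gamma>: "preserves_energy \<Gamma> x" and xy: "x \<in> \<Omega>" "y \<noteq> 0"
  shows "\<Gamma> 1 i j = spray2 L 1 i j x y - pdy j (conn_f \<Gamma> i) x y * pdy 2 L x y
      - conn_f \<Gamma> i x y * pdy j (pdy 2 L) x y"
    and "\<Gamma> 2 i j = spray2 L 2 i j x y + pdy j (conn_f \<Gamma> i) x y * pdy 1 L x y
      + conn_f \<Gamma> i x y * pdy j (pdy 1 L) x y"
proof -
  have eq: "conn_diff \<Gamma> i l x y = conn_f \<Gamma> i x y * Vfield L x y $ l" if "y \<noteq> 0" for l y
    using conn_diff_eq[OF \<Gamma> xy(1) that] by (simp add: conn_f_def V0_nth)
  have "pdy j (conn_diff \<Gamma> i 1) x y = pdy j (\<lambda>x y. - (conn_f \<Gamma> i x y * pdy 2 L x y)) x y"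
    by (rule pdy_cong[OF xy]) (simp add: eq Vfield_nth)
  then show "\<Gamma> 1 i j = spray2 L 1 i j x y - pdy j (conn_f \<Gamma> i) x y * pdy 2 L x y
      - conn_f \<Gamma> i x y * pdy j (pdy 2 L) x y"
    by (simp add: pdy_conn_diff xy pdy_rules slit_smooth_all slit_smooth_conn_f)
  have "pdy j (conn_diff \<Gamma> i 2) x y = pdy j (\<lambda>x y. conn_f \<Gamma> i x y * pdy 1 L x y) x y"
    by (rule pdy_cong[OF xy]) (simp add: eq Vfield_nth)
  then show "\<Gamma> 2 i j = spray2 L 2 i j x y + pdy j (conn_f \<Gamma> i) x y * pdy 1 L x y
      + conn_f \<Gamma> i x y * pdy j (pdy 1 L) x y"
    by (simp add: pdy_conn_diff xy pdy_rules slit_smooth_all slit_smooth_conn_f)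
qed

text \<open>Along an integral curve \<open>c\<close> of \<open>V\<^sub>0\<close> on the indicatrix, \<open>\<phi> = conn_phi \<Gamma> i\<close> satisfies \<open>\<phi>' = \<alpha>\<^sub>i\<close> and
  \<open>\<omega>\<^sub>i + \<phi>'' = \<phi> \<lambda>' + \<lambda> \<phi>'\<close>. Both are the components of one vector equation for \<open>D\<^sub>i \<circ> c = \<phi> c'\<close>.\<close>

lemma along_indicatrix:
  assumes \<Gamma>: "preserves_energy \<Gamma> x" and x: "x \<in> \<Omega>"
    and c: "\<And>t. (c has_vector_derivative V0 L x (c t)) (at t)" and c0: "\<And>t. c t \<noteq> 0"
    and c1: "\<And>t. L x (c t) = 1"
  shows "((\<lambda>t. conn_phi \<Gamma> i x (c t)) has_real_derivative alpha L i x (c t)) (at t)"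
    and "\<exists>a. ((\<lambda>t. alpha L i x (c t)) has_real_derivative a) (at t)"
    and "omega L i x (c t) + deriv (\<lambda>t. alpha L i x (c t)) t =
      conn_phi \<Gamma> i x (c t) * deriv (\<lambda>t. main_scalar L x (c t)) t
      + main_scalar L x (c t) * alpha L i x (c t)"
proof -
  have D: "((\<lambda>t. h x (c t)) has_real_derivative dV h x (c t)) (at t)" if "slit_smooth \<Omega> h" for h t
    using slit_smooth_chain_fibre[OF that x c0 c] by (simp add: dV_def)
  define v where "v = (\<lambda>l t. V0 L x (c t) $ l)"
  define lam where "lam = (\<lambda>t. main_scalar L x (c t))"
  define lam1 where "lam1 = (\<lambda>t. dV (main_scalar L) x (c t))"
  define p where "p = (\<lambda>t. conn_phi \<Gamma> i x (c t))"
  define p1 where "p1 = (\<lambda>t. dV (conn_phi \<Gamma> i) x (c t))"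
  define p2 where "p2 = (\<lambda>t. dV (dV (conn_phi \<Gamma> i)) x (c t))"
  define S2 where "S2 = (\<lambda>l j t. spray2 L l i j x (c t))"
  define S3 where "S3 = (\<lambda>l j k t. spray3 L l i j k x (c t))"
  have dc: "((\<lambda>t. c t $ l) has_real_derivative v l t) (at t)" for l t
    using bounded_linear.has_vector_derivative[OF bounded_linear_vec_nth c, of l t]
    by (simp add: has_real_derivative_iff_has_vector_derivative v_def)
  have dv: "(v l has_real_derivative - c t $ l - lam t * v l t) (at t)" for l t
    using D[OF slit_smooth_V0[of l], of t] by (simp add: dV_V0[OF x c0] c1 v_def lam_def)
  have dlam: "(lam has_real_derivative lam1 t) (at t)" for t
    unfolding lam_def lam1_def by (intro D slit_smooth_main_scalar)
  have dp: "(p has_real_derivative p1 t) (at t)" for t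
    unfolding p_def p1_def by (intro D slit_smooth_conn_phi)
  have dp1: "(p1 has_real_derivative p2 t) (at t)" for t
    unfolding p1_def p2_def by (intro D slit_smooth_dV slit_smooth_conn_phi)
  have dS2: "(S2 l j has_real_derivative (\<Sum>k\<in>UNIV. S3 l j k t * v k t)) (at t)" for l j t
    using D[OF slit_smooth_spray2[of l i j], of t] by (simp add: S2_def S3_def spray3_def dV_def v_def)
  have W: "conn_diff \<Gamma> i l x (c t) = p t * v l t" for l t
    unfolding p_def v_def by (rule conn_diff_eq[OF \<Gamma> x c0])
  \<comment> \<open>Two expressions for the first derivative of \<open>D\<^sub>i \<circ> c = \<phi> c'\<close>.\<close>
  have W1: "(\<Sum>j\<in>UNIV. (\<Gamma> l i j - S2 l j t) * v j t) = p1 t * v l t + p t * (- c t $ l - lam t * v l t)" for l t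
  proof -
    have "((\<lambda>t. conn_diff \<Gamma> i l x (c t)) has_real_derivative (\<Sum>j\<in>UNIV. (\<Gamma> l i j - S2 l j t) * v j t)) (at t)"
      using D[OF slit_smooth_conn_diff[of \<Gamma> i l], of t] by (simp add: dV_def pdy_conn_diff[OF x c0] S2_def v_def)
    moreover have "((\<lambda>t. conn_diff \<Gamma> i l x (c t)) has_real_derivative
        p1 t * v l t + p t * (- c t $ l - lam t * v l t)) (at t)"
      unfolding W using DERIV_mult[OF dp[of t] dv[of l t]] by (simp add: algebra_simps)
    ultimately show ?thesis by (rule DERIV_unique)
  qed
  \<comment> \<open>Two expressions for its second derivative; the second fibre derivative of \<open>D\<^sub>i\<close> is \<open>- G\<^sub>i\<^sub>j\<^sub>k\<close>,
      since \<open>\<Gamma>\<close> contributes a linear term only.\<close>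
  have W2: "(\<Sum>j\<in>UNIV. - (\<Sum>k\<in>UNIV. S3 l j k t * v k t) * v j t + (\<Gamma> l i j - S2 l j t) * (- c t $ j - lam t * v j t))
     = p2 t * v l t + p1 t * (- c t $ l - lam t * v l t) + p1 t * (- c t $ l - lam t * v l t)
     + p t * (- v l t - lam1 t * v l t - lam t * (- c t $ l - lam t * v l t))" for l t
  proof -
    have "((\<lambda>t. \<Sum>j\<in>UNIV. (\<Gamma> l i j - S2 l j t) * v j t) has_real_derivative
      (\<Sum>j\<in>UNIV. - (\<Sum>k\<in>UNIV. S3 l j k t * v k t) * v j t + (\<Gamma> l i j - S2 l j t) * (- c t $ j - lam t * v j t))) (at t)"
      unfolding sum_2 by (rule derivative_eq_intros dS2 dv refl | simp add: sum_2 algebra_simps)+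
    moreover have "((\<lambda>t. \<Sum>j\<in>UNIV. (\<Gamma> l i j - S2 l j t) * v j t) has_real_derivative
       p2 t * v l t + p1 t * (- c t $ l - lam t * v l t) + p1 t * (- c t $ l - lam t * v l t)
       + p t * (- v l t - lam1 t * v l t - lam t * (- c t $ l - lam t * v l t))) (at t)"
      unfolding W1 by (rule derivative_eq_intros dp dp1 dc dv dlam refl | simp add: algebra_simps)+
    ultimately show ?thesis by (rule DERIV_unique)
  qed
  have W0: "(\<Sum>j\<in>UNIV. (\<Gamma> l i j - S2 l j t) * c t $ j) = p t * v l t" for l t
    using euler[OF slit_smooth_conn_diff[of \<Gamma> i l] slit_hom_conn_diff x c0[of t]]
    by (simp add: W pdy_conn_diff[OF x c0] S2_def mult.commute)
  \<comment> \<open>The \<open>c\<close>-component of \<open>Q\<close> will give \<open>\<alpha>\<^sub>i\<close>, its \<open>c'\<close>-component \<open>\<omega>\<^sub>i\<close>.\<close>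
  define Q where "Q = (\<lambda>l t. \<Sum>j\<in>UNIV. \<Sum>k\<in>UNIV. S3 l j k t * v j t * v k t)"
  have Q: "Q l t = (lam1 t * p t + lam t * p1 t - p2 t) * v l t + 2 * p1 t * c t $ l" for l t
  proof -
    have "Q l t = - (\<Sum>j\<in>UNIV. - (\<Sum>k\<in>UNIV. S3 l j k t * v k t) * v j t + (\<Gamma> l i j - S2 l j t) * (- c t $ j - lam t * v j t))
       - (\<Sum>j\<in>UNIV. (\<Gamma> l i j - S2 l j t) * c t $ j) - lam t * (\<Sum>j\<in>UNIV. (\<Gamma> l i j - S2 l j t) * v j t)"
      by (simp add: Q_def sum_2 algebra_simps)
    then show ?thesis unfolding W0 W1 W2 by (simp add: algebra_simps)
  qed
  have al: "alpha L i x (c t) = p1 t" for t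
  proof -
    have "2 * alpha L i x (c t) = (\<Sum>l\<in>UNIV. pdy l E x (c t) * Q l t)"
      using alpha_eq[OF x c0[of t], of i] by (simp add: Q_def S3_def v_def)
    also have "\<dots> = (lam1 t * p t + lam t * p1 t - p2 t) * (\<Sum>l\<in>UNIV. pdy l E x (c t) * V0 L x (c t) $ l)
        + 2 * p1 t * (\<Sum>l\<in>UNIV. c t $ l * pdy l E x (c t))"
      by (simp add: Q sum_2 v_def algebra_simps)
    also have "\<dots> = 2 * p1 t" by (simp add: V0_tangent[OF x c0] euler_E[OF x c0] c1)
    finally show ?thesis by simp
  qed
  have "omega L i x (c t) = lam1 t * p t + lam t * p1 t - p2 t"
  proof -
    have H: "gprod L x (c t) (V0 L x (c t)) (axis l 1) = V0_covector x (c t) $ l" for l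
      using exhaust_2[of l] by (auto simp: gprod_def V0_covector_def sum_2 axis_def)
    have "omega L i x (c t) = (\<Sum>l\<in>UNIV. V0_covector x (c t) $ l * Q l t)"
      by (simp add: omega_def H Q_def S3_def v_def sum_2 algebra_simps)
    also have "\<dots> = (lam1 t * p t + lam t * p1 t - p2 t) * (\<Sum>l\<in>UNIV. V0_covector x (c t) $ l * V0 L x (c t) $ l)
        + 2 * p1 t * (\<Sum>l\<in>UNIV. V0_covector x (c t) $ l * c t $ l)"
      by (simp add: Q sum_2 v_def algebra_simps)
    also have "(\<Sum>l\<in>UNIV. V0_covector x (c t) $ l * V0 L x (c t) $ l) = 1"
      by (rule V0_covector_V0[OF x c0])
    also have "(\<Sum>l\<in>UNIV. V0_covector x (c t) $ l * c t $ l) = 0"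
      by (rule V0_covector_y[OF x c0])
    finally show ?thesis by simp
  qed
  moreover have "deriv (\<lambda>t. alpha L i x (c t)) t = p2 t"
    unfolding al by (rule DERIV_imp_deriv) (rule dp1)
  moreover have "deriv (\<lambda>t. main_scalar L x (c t)) t = lam1 t"
    using dlam unfolding lam_def by (rule DERIV_imp_deriv)
  ultimately show "omega L i x (c t) + deriv (\<lambda>t. alpha L i x (c t)) t =
      conn_phi \<Gamma> i x (c t) * deriv (\<lambda>t. main_scalar L x (c t)) t
      + main_scalar L x (c t) * alpha L i x (c t)"
    by (simp add: al p_def lam_def)
  show "((\<lambda>t. conn_phi \<Gamma> i x (c t)) has_real_derivative alpha L i x (c t)) (at t)"
    using dp[of t] by (simp add: al p_def)
  show "\<exists>a. ((\<lambda>t. alpha L i x (c t)) has_real_derivative a) (at t)"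
    unfolding al using dp1 by blast
qed

end

section \<open>Local solutions of linear differential equations\<close>

lemma bounded_bilinear_matrix_vector_mult: "bounded_bilinear ((*v) :: real^'n^'m \<Rightarrow> real^'n \<Rightarrow> real^'m)"
  unfolding bilinear_conv_bounded_bilinear[symmetric] bilinear_def
  by (auto intro!: linearI simp: matrix_vector_mult_add_rdistrib matrix_vector_right_distrib
      scaleR_matrix_vector_assoc matrix_vector_mult_scaleR)

text \<open>Picard iteration as a contraction on the bounded continuous functions on the whole line, with time
  clamped to a short interval \<open>[0, d]\<close>.\<close>

lemma linear_ode_local:
  fixes B :: "real \<Rightarrow> real^'n^'n" and y0 :: "real^'n"
  assumes B: "continuous_on {0..d0} B" and d0: "0 < d0"
  shows "\<exists>d \<xi>. 0 < d \<and> d \<le> d0 \<and> continuous_on UNIV \<xi> \<and> \<xi> 0 = y0 \<and>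
    (\<forall>t\<in>{0<..<d}. (\<xi> has_vector_derivative B t *v \<xi> t) (at t))"
proof -
  interpret mv: bounded_bilinear "(*v) :: real^'n^'n \<Rightarrow> real^'n \<Rightarrow> real^'n"
    by (rule bounded_bilinear_matrix_vector_mult)
  obtain K0 where K0: "0 < K0" "\<And>X v. norm ((X :: real^'n^'n) *v v) \<le> norm X * norm v * K0"
    using mv.pos_bounded by blast
  have "bounded (B ` {0..d0})" by (intro compact_imp_bounded compact_continuous_image B) simp
  then obtain K1 where K1: "0 < K1" "\<And>s. s \<in> {0..d0} \<Longrightarrow> norm (B s) \<le> K1"
    by (auto simp: bounded_pos)
  define K where "K = K1 * K0"
  have K: "0 < K" using K0 K1 by (simp add: K_def)
  have Kb: "norm (B s *v v) \<le> K * norm v" if "s \<in> {0..d0}" for s v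
  proof -
    have "norm (B s *v v) \<le> norm (B s) * norm v * K0" by (rule K0)
    also have "\<dots> \<le> K1 * norm v * K0"
      using K1 K0 that by (intro mult_right_mono) auto
    finally show ?thesis by (simp add: K_def mult_ac)
  qed
  \<comment> \<open>This makes the integral operator a contraction with factor \<open>1/2\<close>.\<close>
  define d where "d = min d0 (1 / (2 * K))"
  have d: "0 < d" "d \<le> d0" "d * K \<le> 1/2"
    using d0 K by (auto simp: d_def min_def field_simps)
  define cl where "cl = (\<lambda>t. max 0 (min d t))"
  have cl: "cl t \<in> {0..d}" for t using d by (auto simp: cl_def)
  have cc: "continuous_on {0..d} (\<lambda>s. B s *v apply_bcontfun g s)" for g :: "real \<Rightarrow>\<^sub>C (real^'n)"
    using d by (intro mv.continuous_on continuous_on_apply_bcontfun continuous_on_subset[OF B]) auto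
  define T where "T = (\<lambda>(g :: real \<Rightarrow>\<^sub>C (real^'n)) t. y0 + integral {0..cl t} (\<lambda>s. B s *v apply_bcontfun g s))"
  have ci: "continuous_on {0..d} (\<lambda>t. integral {0..t} (\<lambda>s. B s *v apply_bcontfun g s))" for g
    by (intro indefinite_integral_continuous_1 integrable_continuous_real cc)
  have "T g \<in> bcontfun" for g
  proof -
    have "continuous_on UNIV cl" unfolding cl_def by (intro continuous_intros)
    then have "continuous_on UNIV (T g)" unfolding T_def
      using cl by (intro continuous_on_add continuous_on_const continuous_on_compose2[OF ci]) auto
    moreover have "bounded ((\<lambda>t. integral {0..t} (\<lambda>s. B s *v apply_bcontfun g s)) ` {0..d})"
      by (intro compact_imp_bounded compact_continuous_image ci) simp
    then obtain b where "\<forall>t\<in>{0..d}. norm (integral {0..t} (\<lambda>s. B s *v apply_bcontfun g s)) \<le> b"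
      by (auto simp: bounded_iff)
    then have "norm (T g t) \<le> norm y0 + b" for t
      unfolding T_def using cl by (intro order_trans[OF norm_triangle_ineq] add_left_mono) blast
    ultimately show ?thesis by (rule bcontfun_normI)
  qed
  then have ap: "apply_bcontfun (Bcontfun (T g)) = T g" for g
    by (rule Bcontfun_inverse)
  have "dist (Bcontfun (T g)) (Bcontfun (T h)) \<le> 1/2 * dist g h" for g h
  proof (rule dist_bound)
    fix t
    have "dist (T g t) (T h t) = norm (integral {0..cl t} (\<lambda>s. B s *v apply_bcontfun g s)
        - integral {0..cl t} (\<lambda>s. B s *v apply_bcontfun h s))"
      by (simp add: T_def dist_norm)
    also have "\<dots> = norm (integral {0..cl t} (\<lambda>s. B s *v apply_bcontfun g s - B s *v apply_bcontfun h s))"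
      using cl[of t]
      by (subst Henstock_Kurzweil_Integration.integral_diff)
        (auto intro!: integrable_continuous_real continuous_on_subset[OF cc])
    also have "\<dots> \<le> (K * dist g h) * (cl t - 0)"
    proof (rule integral_bound)
      show "0 \<le> cl t" using cl[of t] by simp
      show "continuous_on {0..cl t} (\<lambda>s. B s *v apply_bcontfun g s - B s *v apply_bcontfun h s)"
        using cl[of t] by (intro continuous_on_diff continuous_on_subset[OF cc]) auto
      fix s assume "s \<in> {0..cl t}"
      then have "s \<in> {0..d0}" using cl[of t] d by auto
      then have "norm (B s *v (apply_bcontfun g s - apply_bcontfun h s)) \<le> K * norm (apply_bcontfun g s - apply_bcontfun h s)"
        by (rule Kb)
      also have "\<dots> \<le> K * dist g h"
        using K dist_bounded[of g s h] by (simp add: dist_norm)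
      finally show "norm (B s *v apply_bcontfun g s - B s *v apply_bcontfun h s) \<le> K * dist g h"
        by (simp add: mv.diff_right)
    qed
    also have "\<dots> \<le> (K * dist g h) * d"
      using cl[of t] K by (intro mult_left_mono) auto
    also have "\<dots> = (d * K) * dist g h" by simp
    also have "\<dots> \<le> 1/2 * dist g h" using d by (intro mult_right_mono) auto
    finally show "dist (apply_bcontfun (Bcontfun (T g)) t) (apply_bcontfun (Bcontfun (T h)) t) \<le> 1/2 * dist g h"
      by (simp add: ap)
  qed
  then obtain g where g: "Bcontfun (T g) = g"
    using banach_fix_type[of "1/2" "\<lambda>g. Bcontfun (T g)"] by auto
  define \<xi> where "\<xi> = apply_bcontfun g"
  have \<xi>: "\<xi> = T g" using ap[of g] g by (simp add: \<xi>_def)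
  have \<xi>_eq: "\<xi> u = y0 + integral {0..u} (\<lambda>s. B s *v \<xi> s)" if "u \<in> {0..d}" for u
  proof -
    have "cl u = u" using that by (simp add: cl_def)
    moreover have "\<xi> u = T g u" by (simp only: \<xi>)
    ultimately show ?thesis by (simp only: T_def \<xi>_def[symmetric])
  qed
  have "(\<xi> has_vector_derivative B t *v \<xi> t) (at t)" if t: "t \<in> {0<..<d}" for t
  proof -
    have "((\<lambda>u. integral {0..u} (\<lambda>s. B s *v \<xi> s)) has_vector_derivative B t *v \<xi> t) (at t within {0..d})"
      using t unfolding \<xi>_def by (intro integral_has_vector_derivative cc) auto
    then have "((\<lambda>u. y0 + integral {0..u} (\<lambda>s. B s *v \<xi> s)) has_vector_derivative B t *v \<xi> t) (at t)"
      using t by (simp add: has_vector_derivative_add_const at_within_Icc_at add.commute[of y0])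
    then show ?thesis
      by (rule has_vector_derivative_transform_within_open[of _ _ _ "{0<..<d}"])
        (use t \<xi>_eq in auto)
  qed
  moreover have "continuous_on UNIV \<xi>" by (simp add: \<xi>_def)
  moreover have "\<xi> 0 = y0" using d by (simp add: \<xi> T_def cl_def)
  ultimately show ?thesis using d by blast
qed

section \<open>Charts and tangent vectors\<close>

lemma chart_inv_mem: "x \<in> chart_image c \<Longrightarrow> chart_inv c x \<in> fst c"
  by (rule inv_into_into)

lemma chart_chart_inv: "x \<in> chart_image c \<Longrightarrow> snd c (chart_inv c x) = x"
  by (rule f_inv_into_f)

context
  fixes M :: "'a topology" and A :: "'a chart set"
  assumes surface: "smooth_surface M A"
begin

lemma atlas_chart: "c \<in> A \<Longrightarrow> is_chart M c"
  using surface by (simp add: smooth_surface_def)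

lemma chart_domain_subset: "c \<in> A \<Longrightarrow> fst c \<subseteq> topspace M"
  using atlas_chart by (simp add: is_chart_def openin_subset)

lemma chart_inv_chart:
  assumes "c \<in> A" "p \<in> fst c"
  shows "chart_inv c (snd c p) = p"
proof -
  have "inj_on (snd c) (topspace (subtopology M (fst c)))"
    using atlas_chart[OF assms(1)] by (auto simp: is_chart_def dest: homeomorphic_imp_injective_map)
  then have "inj_on (snd c) (fst c)"
    using chart_domain_subset[OF assms(1)] by (simp add: Int_absorb1)
  then show ?thesis using assms(2) by simp
qed

lemma open_chart_image: "c \<in> A \<Longrightarrow> open (chart_image c)"
  using atlas_chart by (simp add: is_chart_def)

lemma open_image_chart:
  assumes c: "c \<in> A" and W: "openin M W"
  shows "open (snd c ` (fst c \<inter> W))"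
proof -
  have hm: "homeomorphic_map (subtopology M (fst c)) (top_of_set (chart_image c)) (snd c)"
    using atlas_chart[OF c] by (simp add: is_chart_def)
  have "openin (subtopology M (fst c)) (fst c \<inter> W)"
    using W by (rule openin_subtopology_Int2)
  then have "openin (top_of_set (chart_image c)) (snd c ` (fst c \<inter> W))"
    using homeomorphic_map_openness_eq[OF hm] by blast
  then show ?thesis using open_chart_image[OF c] openin_open_trans by blast
qed

text \<open>Smoothness near a point can be tested in any chart around it.\<close>

lemma smooth_near_iff:
  assumes c: "c \<in> A" and p: "p \<in> fst c"
  shows "smooth_near A p f \<longleftrightarrow> (\<exists>W. open W \<and> snd c p \<in> W \<and> W \<subseteq> chart_image c \<and>
    smooth_on W (f \<circ> chart_inv c))"
proof
  assume "smooth_near A p f"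
  then obtain d W where d: "d \<in> A" "p \<in> fst d" and W: "open W" "snd d p \<in> W" "W \<subseteq> chart_image d"
    and f: "smooth_on W (f \<circ> chart_inv d)"
    unfolding smooth_near_def by blast
  \<comment> \<open>The transition map \<open>snd d \<circ> chart_inv c\<close> is smooth on the open set \<open>R\<close>.\<close>
  define R where "R = snd c ` (fst c \<inter> fst d)"
  have R: "open R" unfolding R_def
    using open_image_chart[OF c] atlas_chart[OF d(1)] by (simp add: is_chart_def)
  have tr: "smooth_on R (snd d \<circ> chart_inv c)"
    using surface c d by (auto simp: smooth_surface_def smooth_compatible_def R_def)
  then have "continuous_on R (snd d \<circ> chart_inv c)"
    by (metis smooth_on_def Ck_on.simps(1))
  then have W': "open (R \<inter> (snd d \<circ> chart_inv c) -` W)"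
    using R W(1) by (rule continuous_open_preimage)
  define W' where "W' = R \<inter> (snd d \<circ> chart_inv c) -` W"
  have eq: "(f \<circ> chart_inv d) ((snd d \<circ> chart_inv c) x) = (f \<circ> chart_inv c) x" if "x \<in> W'" for x
  proof -
    from that obtain q where q: "q \<in> fst c" "q \<in> fst d" "x = snd c q" by (auto simp: W'_def R_def)
    then show ?thesis by (simp add: chart_inv_chart c d)
  qed
  have "Ck_on k W' (f \<circ> chart_inv c)" for k
  proof (rule Ck_on_cong)
    show "open W'" using W' by (simp add: W'_def)
    show "Ck_on k W' (\<lambda>x. (f \<circ> chart_inv d) ((snd d \<circ> chart_inv c) x))"
    proof (rule Ck_on_compose[where g = "snd d \<circ> chart_inv c" and f = "f \<circ> chart_inv d"])
      show "open W'" using W' by (simp add: W'_def)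
      show "(snd d \<circ> chart_inv c) ` W' \<subseteq> W" by (auto simp: W'_def)
      show "Ck_on k W (f \<circ> chart_inv d)" using f by (simp add: smooth_on_def)
      show "Ck_on k W' (snd d \<circ> chart_inv c)"
        using tr Ck_on_subset[of k R _ W'] by (auto simp: smooth_on_def W'_def)
    qed
  qed (rule eq)
  moreover have "snd c p \<in> W'" using p d W by (auto simp: W'_def R_def chart_inv_chart c)
  moreover have "W' \<subseteq> chart_image c" by (auto simp: W'_def R_def)
  ultimately show "\<exists>W. open W \<and> snd c p \<in> W \<and> W \<subseteq> chart_image c \<and> smooth_on W (f \<circ> chart_inv c)"
    using W' by (auto simp: smooth_on_def W'_def)
qed (use c p in \<open>auto simp: smooth_near_def\<close>)

lemma smooth_near_common:
  assumes c: "c \<in> A" "p \<in> fst c" and f: "smooth_near A p f" and g: "smooth_near A p g"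
  obtains W where "open W" "snd c p \<in> W" "W \<subseteq> chart_image c"
    "smooth_on W (f \<circ> chart_inv c)" "smooth_on W (g \<circ> chart_inv c)"
proof -
  obtain V W where "open V" "snd c p \<in> V" "V \<subseteq> chart_image c" "smooth_on V (f \<circ> chart_inv c)"
    "open W" "snd c p \<in> W" "W \<subseteq> chart_image c" "smooth_on W (g \<circ> chart_inv c)"
    using f g unfolding smooth_near_iff[OF c] by blast
  then show ?thesis
    by (intro that[of "V \<inter> W"]) (auto simp: smooth_on_def intro: Ck_on_subset)
qed

lemma smooth_near_lincomb:
  assumes c: "c \<in> A" "p \<in> fst c" and f: "smooth_near A p f" and g: "smooth_near A p g"
  shows "smooth_near A p (\<lambda>q. a * f q + b * g q)"
proof -
  obtain W where W: "open W" "snd c p \<in> W" "W \<subseteq> chart_image c"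
    and "smooth_on W (f \<circ> chart_inv c)" "smooth_on W (g \<circ> chart_inv c)"
    using smooth_near_common[OF assms] by blast
  then have "smooth_on W ((\<lambda>q. a * f q + b * g q) \<circ> chart_inv c)"
    by (auto simp: smooth_on_def o_def intro!: Ck_on_add Ck_on_mult Ck_on_const)
  then show ?thesis using W smooth_near_iff[OF c] by blast
qed

lemma smooth_near_mult:
  assumes c: "c \<in> A" "p \<in> fst c" and f: "smooth_near A p f" and g: "smooth_near A p g"
  shows "smooth_near A p (\<lambda>q. f q * g q)"
proof -
  obtain W where W: "open W" "snd c p \<in> W" "W \<subseteq> chart_image c"
    and "smooth_on W (f \<circ> chart_inv c)" "smooth_on W (g \<circ> chart_inv c)"
    using smooth_near_common[OF assms] by blast
  then have "smooth_on W ((\<lambda>q. f q * g q) \<circ> chart_inv c)"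
    by (auto simp: smooth_on_def o_def intro!: Ck_on_mult)
  then show ?thesis using W smooth_near_iff[OF c] by blast
qed

lemma coord_vec_deriv:
  assumes c: "c \<in> A" "p \<in> fst c" and f: "smooth_near A p f"
  shows "((\<lambda>t. f (chart_inv c (snd c p + t *\<^sub>R axis i 1))) has_real_derivative coord_vec A c i p f) (at 0)"
proof -
  obtain W where W: "open W" "snd c p \<in> W" "smooth_on W (f \<circ> chart_inv c)"
    using f unfolding smooth_near_iff[OF c] by blast
  then have "Ck_on (Suc 0) W (f \<circ> chart_inv c)" by (simp only: smooth_on_def)
  from deriv_along_line[OF Ck_on_SucD[OF this W(2)], of "axis i 1"]
  have "((\<lambda>t. f (chart_inv c (snd c p + t *\<^sub>R axis i 1))) has_real_derivative
      frechet_derivative (f \<circ> chart_inv c) (at (snd c p)) (axis i 1)) (at 0)"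
    by simp
  then show ?thesis using f DERIV_imp_deriv by (fastforce simp: coord_vec_def)
qed

lemma smooth_near_local:
  assumes c: "c \<in> A" "p \<in> fst c" and V: "openin M V" "p \<in> V" "\<And>q. q \<in> V \<Longrightarrow> f q = g q"
    and f: "smooth_near A p f"
  shows "smooth_near A p g" and "coord_vec A c i p f = coord_vec A c i p g"
proof -
  define R where "R = snd c ` (fst c \<inter> V)"
  have R: "open R" "snd c p \<in> R" "R \<subseteq> chart_image c"
    using open_image_chart[OF c(1) V(1)] c V by (auto simp: R_def)
  have eq: "(f \<circ> chart_inv c) x = (g \<circ> chart_inv c) x" if "x \<in> R" for x
    using that V(3) by (auto simp: R_def chart_inv_chart c)
  obtain W where W: "open W" "snd c p \<in> W" "W \<subseteq> chart_image c" "smooth_on W (f \<circ> chart_inv c)"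
    using f unfolding smooth_near_iff[OF c] by blast
  have "Ck_on k (W \<inter> R) (g \<circ> chart_inv c)" for k
  proof (rule Ck_on_cong)
    show "open (W \<inter> R)" using W R by blast
    show "Ck_on k (W \<inter> R) (f \<circ> chart_inv c)"
      using W(4) by (auto simp: smooth_on_def intro: Ck_on_subset)
  qed (use eq in auto)
  then have "smooth_on (W \<inter> R) (g \<circ> chart_inv c)" by (simp add: smooth_on_def)
  then show g: "smooth_near A p g"
    unfolding smooth_near_iff[OF c] using W R by (intro exI[of _ "W \<inter> R"]) auto
  have "((\<lambda>t. g (chart_inv c (snd c p + t *\<^sub>R axis i 1))) has_real_derivative coord_vec A c i p f) (at 0)"
  proof (rule has_field_derivative_transform_within_open[OF coord_vec_deriv[OF c f]])
    show "open ((\<lambda>t. snd c p + t *\<^sub>R axis i 1) -` R)"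
      by (intro open_vimage continuous_intros R)
    show "0 \<in> (\<lambda>t. snd c p + t *\<^sub>R axis i 1) -` R" using R by simp
  qed (use eq in auto)
  then show "coord_vec A c i p f = coord_vec A c i p g"
    using coord_vec_deriv[OF c g] DERIV_unique by blast
qed

text \<open>Besides the derivation rules for \<open>\<partial>/\<partial>u\<^sup>i\<close> this needs that smoothness near \<open>p\<close> is preserved by linear
  combinations and products, since tangent vectors are normalized to vanish on other functions.\<close>

lemma tangent_of_in_tangent_space:
  assumes c: "c \<in> A" "p \<in> fst c"
  shows "tangent_of A c p y \<in> tangent_space M A p"
proof -
  have 1: "coord_vec A c i p (\<lambda>q. a * f q + b * g q) = a * coord_vec A c i p f + b * coord_vec A c i p g"
    if "smooth_near A p f" "smooth_near A p g" for f g a b i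
    by (rule DERIV_unique[OF coord_vec_deriv[OF c smooth_near_lincomb[OF c that]]])
      (intro DERIV_add DERIV_cmult coord_vec_deriv[OF c] that)
  have 2: "coord_vec A c i p (\<lambda>q. f q * g q) = coord_vec A c i p f * g p + f p * coord_vec A c i p g"
    if "smooth_near A p f" "smooth_near A p g" for f g i
  proof (rule DERIV_unique[OF coord_vec_deriv[OF c smooth_near_mult[OF c that]]])
    show "((\<lambda>t. f (chart_inv c (snd c p + t *\<^sub>R axis i 1)) * g (chart_inv c (snd c p + t *\<^sub>R axis i 1)))
        has_real_derivative coord_vec A c i p f * g p + f p * coord_vec A c i p g) (at 0)"
      using DERIV_mult[OF coord_vec_deriv[OF c that(1)] coord_vec_deriv[OF c that(2)], of i i]
      by (simp add: chart_inv_chart[OF c] mult.commute add.commute)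
  qed
  have 3: "coord_vec A c i p f = coord_vec A c i p g"
    if "openin M W" "p \<in> W" "\<forall>q\<in>W. f q = g q" for f g W i
  proof (cases "smooth_near A p f")
    case True
    then show ?thesis using smooth_near_local(2)[OF c that(1,2)] that(3) by blast
  next
    case False
    then have "\<not> smooth_near A p g" using smooth_near_local(1)[OF c that(1,2), of g f] that(3) by auto
    then show ?thesis using False by (simp add: coord_vec_def)
  qed
  show ?thesis
    unfolding tangent_space_def tangent_of_def
  proof (intro CollectI conjI allI impI)
    show "(\<Sum>i\<in>UNIV. y $ i * coord_vec A c i p f) = (\<Sum>i\<in>UNIV. y $ i * coord_vec A c i p g)"
      if "openin M W" "p \<in> W" "\<forall>q\<in>W. f q = g q" for f g W
      using 3[OF that] by simp
    show "(\<Sum>i\<in>UNIV. y $ i * coord_vec A c i p f) = 0" if "\<not> smooth_near A p f" for f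
      using that by (simp add: coord_vec_def)
  qed (simp_all add: 1 2 sum_2 algebra_simps)
qed

lemma vcomp_tangent_of:
  assumes c: "c \<in> A" "p \<in> fst c"
  shows "vcomp c (tangent_of A c p y) = y"
proof -
  have near: "smooth_near A p (\<lambda>q. snd c q $ j)" for j
  proof -
    have "Ck_on k (chart_image c) ((\<lambda>q. snd c q $ j) \<circ> chart_inv c)" for k
      by (rule Ck_on_cong[OF open_chart_image[OF c(1)] _
            Ck_on_bounded_linear[OF open_chart_image[OF c(1)] bounded_linear_vec_nth[of j]]])
        (simp add: chart_chart_inv)
    then show ?thesis
      unfolding smooth_near_iff[OF c] smooth_on_def using c open_chart_image[OF c(1)]
      by (intro exI[of _ "chart_image c"]) auto
  qed
  have "coord_vec A c i p (\<lambda>q. snd c q $ j) = axis i 1 $ j" for i j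
  proof (rule DERIV_unique[OF coord_vec_deriv[OF c near]])
    have "((\<lambda>t. (snd c p + t *\<^sub>R axis i 1) $ j) has_real_derivative axis i 1 $ j) (at 0)"
      by (auto intro!: derivative_eq_intros)
    then show "((\<lambda>t. snd c (chart_inv c (snd c p + t *\<^sub>R axis i 1)) $ j) has_real_derivative axis i 1 $ j) (at 0)"
    proof (rule has_field_derivative_transform_within_open)
      show "open ((\<lambda>t. snd c p + t *\<^sub>R axis i 1) -` chart_image c)"
        by (intro open_vimage continuous_intros open_chart_image c)
      show "0 \<in> (\<lambda>t. snd c p + t *\<^sub>R axis i 1) -` chart_image c" using c by simp
    qed (simp add: chart_chart_inv)
  qed
  then show ?thesis by (simp add: vcomp_def tangent_of_def vec_eq_iff forall_2 sum_2 axis_def)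
qed

lemma local_rep_homogeneous:
  assumes F: "finsler_metric M A F" and c: "c \<in> A" and x: "x \<in> chart_image c" and t: "0 < t"
  shows "local_rep A c F x (t *\<^sub>R y) = t * local_rep A c F x y"
proof -
  let ?p = "chart_inv c x"
  have p: "?p \<in> fst c" "?p \<in> topspace M" using chart_inv_mem[OF x] chart_domain_subset[OF c] by auto
  have "tangent_of A c ?p (t *\<^sub>R y) = (\<lambda>f. t * tangent_of A c ?p y f)"
    by (simp add: tangent_of_def fun_eq_iff sum_2 algebra_simps)
  then show ?thesis
    using F p t tangent_of_in_tangent_space[OF c p(1)]
    by (simp add: finsler_metric_def local_rep_def)
qed

lemma finsler_chart_local_rep:
  assumes F: "finsler_metric M A F" and c: "c \<in> A"
  shows "finsler_chart (chart_image c) (local_rep A c F)"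
proof
  let ?L = "local_rep A c F"
  show "open (chart_image c)" by (rule open_chart_image[OF c])
  have L: "smooth_on (chart_image c \<times> - {0}) (\<lambda>(x, y). ?L x y)"
    "\<forall>x\<in>chart_image c. \<forall>y. y \<noteq> 0 \<longrightarrow> (\<forall>w. w \<noteq> 0 \<longrightarrow> gprod ?L x y w w > 0)"
    using F c by (auto simp: finsler_metric_def Let_def)
  then show "slit_smooth (chart_image c) ?L" by (simp add: slit_smooth_def)
  show "0 < gprod ?L x y w w" if "x \<in> chart_image c" "y \<noteq> 0" "w \<noteq> 0" for x y w
    using L that by blast
  show "slit_hom (chart_image c) 1 ?L"
    using local_rep_homogeneous[OF F c] by (simp add: slit_hom_def)
qed

end

section \<open>Compatibility in coordinates\<close>

text \<open>Take the coordinate line in direction \<open>i\<close> and a parallel field along it. Then \<open>L\<close> is constant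
  along the field, and differentiating gives the equation at interior points of the parameter interval.
  The solution of the differential equation has its initial value at the left end point, so the
  equation at \<open>(x, y)\<close> itself is obtained as a one-sided limit.\<close>

lemma compatible_in_chart:
  fixes M :: "'a topology" and A :: "'a chart set"
  assumes surface: "smooth_surface M A" and F: "finsler_metric M A F"
    and lin: "linear_connection M A nabla" and compat: "compatible_connection M A F nabla"
    and c: "c \<in> A" and x: "x \<in> chart_image c" and y: "y \<noteq> 0"
  defines "L \<equiv> local_rep A c F" and "\<Gamma> \<equiv> (\<lambda>l i j x. christoffel A nabla c l i j (chart_inv c x))"
  shows "pdx i L x y = (\<Sum>l\<in>UNIV. (\<Sum>j\<in>UNIV. \<Gamma> l i j x * y $ j) * pdy l L x y)"
proof -
  interpret finsler_chart "chart_image c" L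
    unfolding L_def by (rule finsler_chart_local_rep[OF surface F c])
  define X where "X = (\<lambda>t. x + t *\<^sub>R axis i (1 :: real))"
  have contX: "continuous_on S X" for S unfolding X_def by (intro continuous_intros)
  have X0: "X 0 = x" by (simp add: X_def)
  have cont\<Gamma>: "continuous_on (chart_image c) (\<Gamma> l i j)" for l i j
  proof -
    have "smooth_on (chart_image c) (\<Gamma> l i j)"
      using lin c by (auto simp: linear_connection_def \<Gamma>_def)
    then show ?thesis by (metis smooth_on_def Ck_on.simps(1))
  qed
  have "open (X -` chart_image c)"
    using contX[of UNIV] open_base by (simp add: open_vimage)
  moreover have "0 \<in> X -` chart_image c" using x by (simp add: X0)
  ultimately obtain e where "e > 0" "\<forall>t. dist t 0 < e \<longrightarrow> t \<in> X -` chart_image c"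
    unfolding open_dist by blast
  then have e: "e > 0" "\<And>t. \<bar>t\<bar> < e \<Longrightarrow> X t \<in> chart_image c" by simp_all
  \<comment> \<open>Parallel fields along the coordinate line satisfy \<open>\<xi>' = B \<xi>\<close>.\<close>
  define B where "B = (\<lambda>t. (\<chi> l j. - \<Gamma> l i j (X t)) :: real^2^2)"
  have "continuous_on {0..e/2} B"
    unfolding B_def using e
    by (intro continuous_on_vec_lambda continuous_on_minus continuous_on_compose2[OF cont\<Gamma> contX]) auto
  then obtain d \<xi> where d: "0 < d" "d \<le> e/2" and cont\<xi>: "continuous_on UNIV \<xi>" and \<xi>0: "\<xi> 0 = y"
    and \<xi>: "\<And>t. t \<in> {0<..<d} \<Longrightarrow> (\<xi> has_vector_derivative B t *v \<xi> t) (at t)"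
    using linear_ode_local[of "e/2" B y] e by auto
  have Xin: "X t \<in> chart_image c" if "t \<in> {0<..<d}" for t using that d e by auto
  let ?I = "{0<..<d}"
  let ?\<gamma> = "\<lambda>t. chart_inv c (X t)"
  let ?Y = "\<lambda>t. tangent_of A c (?\<gamma> t) (\<xi> t)"
  have \<gamma>: "?\<gamma> t \<in> fst c" "snd c (?\<gamma> t) = X t" if "t \<in> ?I" for t
    by (rule chart_inv_mem[OF Xin[OF that]], rule chart_chart_inv[OF Xin[OF that]])
  have vY: "vcomp c (?Y t) = \<xi> t" if "t \<in> ?I" for t
    by (rule vcomp_tangent_of[OF surface c \<gamma>(1)[OF that]])
  have "smooth_on ?I (snd c \<circ> ?\<gamma>)"
    unfolding smooth_on_def
  proof
    fix k
    have "Ck_on k ?I X"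
      unfolding X_def by (intro Ck_on_add Ck_on_const Ck_on_bounded_linear bounded_linear_scaleR_left) auto
    then show "Ck_on k ?I (snd c \<circ> ?\<gamma>)"
      by (rule Ck_on_cong[rotated -1]) (use \<gamma> in auto)
  qed
  then have sc: "smooth_curve A ?I ?\<gamma>"
    unfolding smooth_curve_def using c \<gamma> by (intro ballI bexI[of _ c] exI[of _ ?I]) auto
  have par: "parallel_along M A nabla ?I ?\<gamma> ?Y"
    unfolding parallel_along_def
  proof (intro ballI conjI bexI[of _ c] allI)
    fix t assume t: "t \<in> ?I"
    show "?Y t \<in> tangent_space M A (?\<gamma> t)"
      by (rule tangent_of_in_tangent_space[OF surface c \<gamma>(1)[OF t]])
    show "?\<gamma> t \<in> fst c" by (rule \<gamma>(1)[OF t])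
    show "c \<in> A" by (rule c)
    fix k
    have dX: "deriv (\<lambda>s. snd c (?\<gamma> s) $ m) t = axis i 1 $ m" for m
    proof (rule DERIV_imp_deriv)
      have "((\<lambda>s. X s $ m) has_real_derivative axis i 1 $ m) (at t)"
        unfolding X_def by (auto intro!: derivative_eq_intros)
      then show "((\<lambda>s. snd c (?\<gamma> s) $ m) has_real_derivative axis i 1 $ m) (at t)"
        by (rule has_field_derivative_transform_within_open[where S = ?I]) (use t \<gamma> in auto)
    qed
    have "((\<lambda>s. \<xi> s $ k) has_real_derivative (B t *v \<xi> t) $ k) (at t)"
      using bounded_linear.has_vector_derivative[OF bounded_linear_vec_nth \<xi>[OF t]]
      by (simp add: has_real_derivative_iff_has_vector_derivative)
    then have "((\<lambda>s. vcomp c (?Y s) $ k) has_real_derivative (B t *v \<xi> t) $ k) (at t)"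
      by (rule has_field_derivative_transform_within_open[where S = ?I]) (use t vY in auto)
    moreover have "(B t *v \<xi> t) $ k = - (\<Sum>m\<in>UNIV. \<Sum>j\<in>UNIV. christoffel A nabla c k m j (?\<gamma> t) *
             deriv (\<lambda>s. snd c (?\<gamma> s) $ m) t * vcomp c (?Y t) $ j)"
      using exhaust_2[of i]
      by (auto simp: dX vY[OF t] matrix_vector_mult_def B_def \<Gamma>_def sum_2 axis_def)
    ultimately show "((\<lambda>s. vcomp c (?Y s) $ k) has_real_derivative - (\<Sum>m\<in>UNIV. \<Sum>j\<in>UNIV. christoffel A nabla c k m j (?\<gamma> t) *
             deriv (\<lambda>s. snd c (?\<gamma> s) $ m) t * vcomp c (?Y t) $ j)) (at t)" by simp
  qed
  have const: "L (X s) (\<xi> s) = L (X t) (\<xi> t)" if "s \<in> ?I" "t \<in> ?I" for s t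
  proof -
    have "open ?I \<and> is_interval ?I \<and> smooth_curve A ?I ?\<gamma> \<and> parallel_along M A nabla ?I ?\<gamma> ?Y"
      using sc par is_interval_oo[of 0 d] by simp
    then have "F (?\<gamma> s) (?Y s) = F (?\<gamma> t) (?Y t)"
      using compat that unfolding compatible_connection_def by blast
    then show ?thesis by (simp add: L_def local_rep_def)
  qed
  define H where "H = (\<lambda>t. pdx i L (X t) (\<xi> t) - (\<Sum>l\<in>UNIV. (\<Sum>j\<in>UNIV. \<Gamma> l i j (X t) * \<xi> t $ j) * pdy l L (X t) (\<xi> t)))"
  have H0: "H t = 0" if t: "t \<in> ?I" and nz: "\<xi> t \<noteq> 0" for t
  proof -
    have "(X has_vector_derivative axis i 1) (at t)"
      unfolding X_def by (auto intro!: derivative_eq_intros)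
    from slit_smooth_chain[OF slit_smooth_L Xin[OF t] nz this \<xi>[OF t]]
    have "((\<lambda>t. L (X t) (\<xi> t)) has_real_derivative H t) (at t)"
      using exhaust_2[of i]
      by (auto simp: H_def B_def matrix_vector_mult_def sum_2 axis_def algebra_simps)
    moreover have "((\<lambda>s. L (X s) (\<xi> s)) has_real_derivative 0) (at t)"
    proof (rule has_field_derivative_transform_within_open)
      show "((\<lambda>_. L (X t) (\<xi> t)) has_real_derivative 0) (at t)" by simp
      show "L (X t) (\<xi> t) = L (X s) (\<xi> s)" if "s \<in> ?I" for s by (rule const[OF t that])
    qed (use t in auto)
    ultimately show ?thesis by (rule DERIV_unique)
  qed
  have right: "(g \<longlongrightarrow> g 0) (at_right 0)" if "continuous_on UNIV g" for g :: "real \<Rightarrow> real^2"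
    by (rule tendsto_within_subset[OF _ subset_UNIV]) (use that in \<open>simp add: continuous_on_def\<close>)
  have lim\<xi>: "(\<xi> \<longlongrightarrow> y) (at_right 0)" using right[OF cont\<xi>] by (simp add: \<xi>0)
  have limX: "(X \<longlongrightarrow> x) (at_right 0)" using right[OF contX] by (simp add: X0)
  have lim: "((\<lambda>t. h (X t) (\<xi> t)) \<longlongrightarrow> h x y) (at_right 0)" if "slit_smooth (chart_image c) h" for h
    using isCont_tendsto_compose[OF slit_smooth_isCont[OF that x y] tendsto_Pair[OF limX lim\<xi>]] by simp
  have lim\<Gamma>: "((\<lambda>t. \<Gamma> l i j (X t)) \<longlongrightarrow> \<Gamma> l i j x) (at_right 0)" for l j
    using cont\<Gamma> open_base x limX
    by (intro isCont_tendsto_compose[of x "\<Gamma> l i j"]) (auto simp: continuous_on_eq_continuous_at)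
  have "(H \<longlongrightarrow> pdx i L x y - (\<Sum>l\<in>UNIV. (\<Sum>j\<in>UNIV. \<Gamma> l i j x * y $ j) * pdy l L x y)) (at_right 0)"
    unfolding H_def
    by (intro tendsto_diff tendsto_sum tendsto_mult lim\<Gamma> tendsto_vec_nth lim\<xi> lim slit_smooth_pdx slit_smooth_pdy slit_smooth_L)
  moreover have "(H \<longlongrightarrow> 0) (at_right 0)"
  proof (rule tendsto_eventually)
    have "\<forall>\<^sub>F t in at_right 0. \<xi> t \<noteq> 0" by (rule tendsto_imp_eventually_ne[OF lim\<xi> y])
    moreover have "\<forall>\<^sub>F t in at_right 0. t \<in> ?I" by (rule eventually_at_right_real[OF d(1)])
    ultimately show "\<forall>\<^sub>F t in at_right 0. H t = 0" by eventually_elim (rule H0)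
  qed
  ultimately have "pdx i L x y - (\<Sum>l\<in>UNIV. (\<Sum>j\<in>UNIV. \<Gamma> l i j x * y $ j) * pdy l L x y) = 0"
    by (intro tendsto_unique[of "at_right (0::real)" H]) simp_all
  then show ?thesis by simp
qed

section \<open>The coefficients of a compatible linear connection\<close>

theorem theorem2:
  fixes M :: "'a topology" and A :: "'a chart set"
    and F :: "'a \<Rightarrow> 'a tangent \<Rightarrow> real" and nabla :: "'a connection"
    and U :: "'a set" and u :: "'a \<Rightarrow> real^2"
    and L :: local_fun and \<Gamma> :: "2 \<Rightarrow> 2 \<Rightarrow> 2 \<Rightarrow> 'a \<Rightarrow> real"
  assumes "smooth_surface M A" and "connected_space M"
    and "generalized_berwald M A F" and "\<not> riemannian M A F"
    and "linear_connection M A nabla" and "compatible_connection M A F nabla"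
    and "(U, u) \<in> A"
  defines "L \<equiv> local_rep A (U, u) F" and "\<Gamma> \<equiv> christoffel A nabla (U, u)"
  shows "\<exists>f :: 2 \<Rightarrow> local_fun.
    (\<forall>i. \<forall>p\<in>U. \<forall>y. y \<noteq> 0 \<longrightarrow>
       f i (u p) differentiable (at y) \<and> (\<forall>t>0. f i (u p) (t *\<^sub>R y) = t * f i (u p) y)) \<and>
    (\<forall>i j. \<forall>p\<in>U. \<forall>y. y \<noteq> 0 \<longrightarrow>
       \<Gamma> 1 i j p = spray2 L 1 i j (u p) y
         - pdy j (f i) (u p) y * pdy 2 L (u p) y - f i (u p) y * pdy j (pdy 2 L) (u p) y \<and>
       \<Gamma> 2 i j p = spray2 L 2 i j (u p) y
         + pdy j (f i) (u p) y * pdy 1 L (u p) y + f i (u p) y * pdy j (pdy 1 L) (u p) y) \<and>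
    (\<forall>c :: 'a \<Rightarrow> real \<Rightarrow> real^2. (\<forall>p\<in>U. indicatrix_param L (u p) (c p)) \<longrightarrow>
       (\<exists>k :: 2 \<Rightarrow> 'a \<Rightarrow> real. \<forall>i. \<forall>p\<in>U. \<forall>t :: real.
          f i (u p) (c p t) = 1 / Vnorm L (u p) (c p t) *
            ((LBINT \<theta>=0..ereal t. alpha L i (u p) (c p \<theta>)) + k i p) \<and>
          omega L i (u p) (c p t) + deriv (\<lambda>s. alpha L i (u p) (c p s)) t =
            ((LBINT \<theta>=0..ereal t. alpha L i (u p) (c p \<theta>)) + k i p) *
              deriv (\<lambda>s. main_scalar L (u p) (c p s)) t
            + main_scalar L (u p) (c p t) * alpha L i (u p) (c p t)))"
proof -
  have F: "finsler_metric M A F" using assms(3) by (simp add: generalized_berwald_def)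
  interpret finsler_chart "u ` U" L
    using finsler_chart_local_rep[OF assms(1) F assms(7)] by (simp add: L_def)
  define G where "G = (\<lambda>x k i j. \<Gamma> k i j (inv_into U u x))"
  have G: "G (u p) k i j = \<Gamma> k i j p" if "p \<in> U" for p k i j
    using chart_inv_chart[OF assms(1,7), of p] that by (simp add: G_def)
  have pe: "preserves_energy (G x) x" if x: "x \<in> u ` U" for x
    unfolding preserves_energy_def
  proof (intro allI impI)
    fix i and y :: "real^2" assume y: "y \<noteq> 0"
    have "pdx i L x y = (\<Sum>l\<in>UNIV. (\<Sum>j\<in>UNIV. G x l i j * y $ j) * pdy l L x y)"
      using compatible_in_chart[OF assms(1) F assms(5-7) _ y, of x i] x
      by (simp add: L_def G_def \<Gamma>_def)
    then show "pdx i E x y = (\<Sum>l\<in>UNIV. (\<Sum>j\<in>UNIV. G x l i j * y $ j) * pdy l E x y)"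
      by (simp add: pdx_E[OF x y] pdy_E[OF x y] sum_2 algebra_simps)
  qed
  define f where "f = (\<lambda>i x. conn_f (G x) i x)"
  \<comment> \<open>Fibre derivatives see only the values over one point, where the coefficients are constants.\<close>
  have pf: "pdy j (f i) x y = pdy j (conn_f (G x) i) x y" for i j x y
    by (simp add: pdy_def f_def)
  have 1: "f i (u p) differentiable (at y)" "\<forall>t>0. f i (u p) (t *\<^sub>R y) = t * f i (u p) y"
    if "p \<in> U" "y \<noteq> 0" for i p y
    using slit_smooth_fibre_differentiable[OF slit_smooth_conn_f, of "u p" y "G (u p)" i]
      slit_homD[OF slit_hom_conn_f, of "u p" y _ "G (u p)" i] that by (auto simp: f_def)
  have 2: "\<Gamma> 1 i j p = spray2 L 1 i j (u p) y
         - pdy j (f i) (u p) y * pdy 2 L (u p) y - f i (u p) y * pdy j (pdy 2 L) (u p) y \<and>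
       \<Gamma> 2 i j p = spray2 L 2 i j (u p) y
         + pdy j (f i) (u p) y * pdy 1 L (u p) y + f i (u p) y * pdy j (pdy 1 L) (u p) y"
    if p: "p \<in> U" and y: "y \<noteq> 0" for i j p y
    using connection_formula[OF pe, of "u p" y i j] p y by (simp add: pf G[OF p]) (simp add: f_def)
  have 3: "\<exists>k :: 2 \<Rightarrow> 'a \<Rightarrow> real. \<forall>i. \<forall>p\<in>U. \<forall>t :: real.
          f i (u p) (c p t) = 1 / Vnorm L (u p) (c p t) *
            ((LBINT \<theta>=0..ereal t. alpha L i (u p) (c p \<theta>)) + k i p) \<and>
          omega L i (u p) (c p t) + deriv (\<lambda>s. alpha L i (u p) (c p s)) t =
            ((LBINT \<theta>=0..ereal t. alpha L i (u p) (c p \<theta>)) + k i p) *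
              deriv (\<lambda>s. main_scalar L (u p) (c p s)) t
            + main_scalar L (u p) (c p t) * alpha L i (u p) (c p t)"
    if c: "\<forall>p\<in>U. indicatrix_param L (u p) (c p)" for c
  proof (intro exI[of _ "\<lambda>i p. conn_phi (G (u p)) i (u p) (c p 0)"] allI ballI)
    fix i p and t :: real assume p: "p \<in> U"
    then have x: "u p \<in> u ` U" by simp
    have dc: "(c p has_vector_derivative V0 L (u p) (c p t)) (at t)" for t
      using c p by (simp add: indicatrix_param_def)
    have c1: "L (u p) (c p t) = 1" for t
      using c p rangeI[of "c p" t] unfolding indicatrix_param_def by blast
    \<comment> \<open>Homogeneity holds on the zero section as well and forces \<open>L = 0\<close> there.\<close>
    have c0: "c p t \<noteq> 0" for t
    proof
      assume "c p t = 0"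
      then have "L (u p) 0 = 1" using c1[of t] by simp
      moreover have "L (u p) 0 = 2 * L (u p) 0"
        using local_rep_homogeneous[OF assms(1) F assms(7), of "u p" 2 0] p by (simp add: L_def)
      ultimately show False by simp
    qed
    note along = along_indicatrix[OF pe[OF x] x dc c0 c1, of i]
    have cont: "continuous_on S (\<lambda>\<theta>. alpha L i (u p) (c p \<theta>))" for S
      using along(2) DERIV_isCont by (intro continuous_at_imp_continuous_on) blast
    have int: "(LBINT \<theta>=0..ereal t. alpha L i (u p) (c p \<theta>)) + conn_phi (G (u p)) i (u p) (c p 0)
        = conn_phi (G (u p)) i (u p) (c p t)"
    proof -
      have "(LBINT \<theta>=ereal 0..ereal t. alpha L i (u p) (c p \<theta>))
          = conn_phi (G (u p)) i (u p) (c p t) - conn_phi (G (u p)) i (u p) (c p 0)"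
        by (rule interval_integral_FTC_finite[OF cont])
          (use along(1) in \<open>auto simp: has_real_derivative_iff_has_vector_derivative[symmetric]
            intro: has_field_derivative_at_within\<close>)
      then show ?thesis by (simp add: zero_ereal_def)
    qed
    show "f i (u p) (c p t) = 1 / Vnorm L (u p) (c p t) *
            ((LBINT \<theta>=0..ereal t. alpha L i (u p) (c p \<theta>)) + conn_phi (G (u p)) i (u p) (c p 0)) \<and>
          omega L i (u p) (c p t) + deriv (\<lambda>s. alpha L i (u p) (c p s)) t =
            ((LBINT \<theta>=0..ereal t. alpha L i (u p) (c p \<theta>)) + conn_phi (G (u p)) i (u p) (c p 0)) *
              deriv (\<lambda>s. main_scalar L (u p) (c p s)) t
            + main_scalar L (u p) (c p t) * alpha L i (u p) (c p t)"
      unfolding int using along(3) by (simp add: f_def conn_f_def)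
  qed
  show ?thesis using 1 2 3 by (intro exI[of _ f]) blast
qed

end
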